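(* There exist absolute constants $c, C > 0$ such that for every $n \ge 1$, every $m \ge 1$ and every search sequence $X = x_1, \ldots, x_m$ with $x_i \in \{1,\ldots,n\}$, $$c \cdot \min_W \Phi_X(W) \;\le\; \min_T \sum_{i=1}^m r(T, x_{i-1}, x_i) \;\le\; C \cdot \min_W \Phi_X(W),$$ where the minimum on the left-hand quantity ranges over all binary search trees $T$ on the keys $\{1,\ldots,n\}$, the minimum over $W$ ranges over all weight vectors $W=(w_1,\ldots,w_n)$ of positive reals, and $$\Phi_X(W) = \sum_{i=1}^m \lg \frac{\sum_{k=\min(x_{i-1},x_i)}^{\max(x_{i-1},x_i)} w_k}{\min(w_{x_{i-1}}, w_{x_i})}.$$ That is, $\min_T \sum_{i=1}^m r(T,x_{i-1},x_i) = \Theta(\min_W \Phi_X(W))$.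
   Context: A static binary search tree (BST) $T$ stores the keys $1,\ldots,n$; no rotations are performed. $d_T(v)$ is the depth of node $v$ in $T$, with the root at depth $0$, and $\mathrm{LCA}_T(i,j)$ is the lowest common ancestor of $i$ and $j$ in $T$. The cost of moving a finger from node $i$ to node $j$ is $r(T,i,j) = d_T(i) + d_T(j) - 2 d_T(\mathrm{LCA}_T(i,j))$. In the lazy finger model each search starts at the node found by the previous search; the first search starts from the starting element $x_0$, which by the paper's convention is the root of the tree $T$ (and the same $x_0$ appears in the weighted expression $\Phi_X$). $\lg$ denotes the base-2 logarithm. *)

theory Defs
  imports Complex_Main "HOL-Library.Tree"
begin

definition bsts :: "nat \<Rightarrow> nat tree set" where
  "bsts n = {T. bst T \<and> set_tree T = {1..n}}"

text \<open>Only meaningful for keys that occur in the tree.\<close>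

fun node_depth :: "'a tree \<Rightarrow> 'a \<Rightarrow> nat" where
  "node_depth \<langle>\<rangle> v = 0"
| "node_depth \<langle>l, a, r\<rangle> v =
     (if v = a then 0
      else if v \<in> set_tree l then Suc (node_depth l v)
      else Suc (node_depth r v))"

text \<open>Every node is an ancestor of itself.\<close>

definition ancestor :: "'a tree \<Rightarrow> 'a \<Rightarrow> 'a \<Rightarrow> bool" where
  "ancestor T u v \<longleftrightarrow> (\<exists>l r. \<langle>l, u, r\<rangle> \<in> subtrees T \<and> v \<in> set_tree \<langle>l, u, r\<rangle>)"

definition lca :: "'a tree \<Rightarrow> 'a \<Rightarrow> 'a \<Rightarrow> 'a" where
  "lca T i j = (ARG_MAX (node_depth T) u. ancestor T u i \<and> ancestor T u j)"

definition move_cost :: "'a tree \<Rightarrow> 'a \<Rightarrow> 'a \<Rightarrow> int" where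
  "move_cost T i j =
     int (node_depth T i) + int (node_depth T j) - 2 * int (node_depth T (lca T i j))"

text \<open>
  A search sequence \<open>x\<^sub>1, \<dots>, x\<^sub>m\<close> is a list \<open>X\<close>, so that \<open>x\<^sub>i = (x\<^sub>0 # X) ! i\<close> for \<open>0 \<le> i \<le> m\<close>.
  For the finger the starting element \<open>x\<^sub>0\<close> is the root \<open>value T\<close> of the tree.
\<close>

definition lazy_finger_cost :: "'a tree \<Rightarrow> 'a list \<Rightarrow> int" where
  "lazy_finger_cost T X =
     (\<Sum>i = 1..length X. move_cost T ((value T # X) ! (i - 1)) ((value T # X) ! i))"

definition min_lazy_finger_cost :: "nat \<Rightarrow> nat list \<Rightarrow> int" where
  "min_lazy_finger_cost n X = (MIN T\<in>bsts n. lazy_finger_cost T X)"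

definition Phi :: "nat \<Rightarrow> nat list \<Rightarrow> (nat \<Rightarrow> real) \<Rightarrow> real" where
  "Phi x\<^sub>0 X w =
     (\<Sum>i = 1..length X.
        let a = (x\<^sub>0 # X) ! (i - 1); b = (x\<^sub>0 # X) ! i
        in log 2 ((\<Sum>k = min a b..max a b. w k) / min (w a) (w b)))"

definition pos_weights :: "nat \<Rightarrow> (nat \<Rightarrow> real) set" where
  "pos_weights n = {w. \<forall>k\<in>{1..n}. 0 < w k}"

text \<open>
  The minimum over the weights is an infimum: it need not be attained, since it can be
  advantageous to let the weight of a key that is never searched tend to \<open>0\<close>.
\<close>

definition min_Phi :: "nat \<Rightarrow> nat \<Rightarrow> nat list \<Rightarrow> real" where
  "min_Phi n x\<^sub>0 X = (INF w\<in>pos_weights n. Phi x\<^sub>0 X w)"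

lemma finite_trees_height_le:
  assumes "finite A"
  shows "finite {t. height t \<le> h \<and> set_tree t \<subseteq> A}"
proof (induction h)
  case 0
  have "{t. height t \<le> 0 \<and> set_tree t \<subseteq> A} \<subseteq> {\<langle>\<rangle>}" by auto
  then show ?case by (rule finite_subset) simp
next
  case (Suc h)
  let ?S = "{t. height t \<le> h \<and> set_tree t \<subseteq> A}"
  have "t \<in> insert \<langle>\<rangle> ((\<lambda>(l, a, r). \<langle>l, a, r\<rangle>) ` (?S \<times> A \<times> ?S))"
    if "height t \<le> Suc h" "set_tree t \<subseteq> A" for t
    using that by (cases t) (auto simp: image_iff)
  then have "{t. height t \<le> Suc h \<and> set_tree t \<subseteq> A}
      \<subseteq> insert \<langle>\<rangle> ((\<lambda>(l, a, r). \<langle>l, a, r\<rangle>) ` (?S \<times> A \<times> ?S))"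
    by blast
  then show ?case
    by (rule finite_subset) (use Suc assms in auto)
qed

lemma size_eq_card_if_bst: "bst t \<Longrightarrow> size t = card (set_tree (t :: 'a::linorder tree))"
proof (induction t)
  case (Node l a r)
  from Node.prems have "a \<notin> set_tree l \<union> set_tree r" "set_tree l \<inter> set_tree r = {}"
    by (auto dest: less_asym)
  with Node show ?case by (simp add: card_Un_disjoint)
qed simp

lemma finite_bsts: "finite (bsts n)"
proof -
  have "height T \<le> n" if "T \<in> bsts n" for T
    using that height_le_size_tree[of T] size_eq_card_if_bst[of T] by (simp add: bsts_def)
  then have "bsts n \<subseteq> {t. height t \<le> n \<and> set_tree t \<subseteq> {1..n}}"
    by (auto simp: bsts_def)
  then show ?thesis by (rule finite_subset) (simp add: finite_trees_height_le)
qed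

lemma bsts_nonempty: "bsts n \<noteq> {}"
proof (induction n)
  case 0
  have "\<langle>\<rangle> \<in> bsts 0" by (simp add: bsts_def)
  then show ?case by blast
next
  case (Suc n)
  then obtain T where "T \<in> bsts n" by blast
  then have "\<langle>T, Suc n, \<langle>\<rangle>\<rangle> \<in> bsts (Suc n)" by (auto simp: bsts_def)
  then show ?case by blast
qed

lemma min_lazy_finger_cost_attained:
  "\<exists>T\<in>bsts n. lazy_finger_cost T X = min_lazy_finger_cost n X"
proof -
  have "min_lazy_finger_cost n X \<in> (\<lambda>T. lazy_finger_cost T X) ` bsts n"
    unfolding min_lazy_finger_cost_def
    by (rule Min_in) (simp_all add: finite_bsts bsts_nonempty)
  then show ?thesis by force
qed

lemma Phi_nonneg:
  assumes w: "w \<in> pos_weights n" and "x\<^sub>0 \<in> {1..n}" "set X \<subseteq> {1..n}"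
  shows "0 \<le> Phi x\<^sub>0 X w"
  unfolding Phi_def Let_def
proof (rule sum_nonneg)
  fix i assume i: "i \<in> {1..length X}"
  define a b where "a = (x\<^sub>0 # X) ! (i - 1)" and "b = (x\<^sub>0 # X) ! i"
  have "a \<in> set (x\<^sub>0 # X)" "b \<in> set (x\<^sub>0 # X)"
    unfolding a_def b_def using i by (intro nth_mem; simp; linarith)+
  then have ab: "a \<in> {1..n}" "b \<in> {1..n}" using assms by auto
  then have pos: "0 < w k" if "k \<in> {min a b..max a b}" for k
  proof -
    have "k \<in> {1..n}" using ab that by (auto simp: min_def max_def split: if_splits)
    then show ?thesis using w by (simp add: pos_weights_def)
  qed
  have "w a \<le> (\<Sum>k = min a b..max a b. w k)"
    by (rule member_le_sum) (use pos in \<open>auto intro: less_imp_le\<close>)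
  moreover have "0 < min (w a) (w b)" using pos by auto
  ultimately have "1 \<le> (\<Sum>k = min a b..max a b. w k) / min (w a) (w b)"
    by (auto simp: le_divide_eq)
  then show "0 \<le> log 2 ((\<Sum>k = min ((x\<^sub>0 # X) ! (i - 1)) ((x\<^sub>0 # X) ! i)..
      max ((x\<^sub>0 # X) ! (i - 1)) ((x\<^sub>0 # X) ! i). w k) /
      min (w ((x\<^sub>0 # X) ! (i - 1))) (w ((x\<^sub>0 # X) ! i)))"
    by (simp add: a_def b_def)
qed

lemma bdd_below_Phi:
  "x\<^sub>0 \<in> {1..n} \<Longrightarrow> set X \<subseteq> {1..n} \<Longrightarrow> bdd_below (Phi x\<^sub>0 X ` pos_weights n)"
  by (rule bdd_belowI2[of _ 0]) (rule Phi_nonneg)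

lemma pos_weights_nonempty: "pos_weights n \<noteq> {}"
proof -
  have "(\<lambda>_. 1) \<in> pos_weights n" by (simp add: pos_weights_def)
  then show ?thesis by blast
qed

end

theory Submission
  imports Defs
begin

text \<open>
  Lower bound: for the weights \<open>w\<^sub>k = 4\<^sup>-\<^sup>d\<^sup>(\<^sup>k\<^sup>)\<close>, where \<open>d\<close> is the depth in an optimal tree, the keys
  of the subtree below the lowest common ancestor of \<open>a\<close> and \<open>b\<close> have total weight at most
  twice the weight of that ancestor, so each summand of \<open>\<Phi>\<close> is at most three times the cost of
  the corresponding move.

  Upper bound: given weights, consider the random tree (a weighted treap) whose root is chosen
  with probability proportional to the weight, recursively in both subtrees. There \<open>k\<close> is an
  ancestor of \<open>v\<close> with probability \<open>w\<^sub>k\<close> divided by the total weight of the keys from \<open>k\<close> to \<open>v\<close>.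
  The cost of a move is bounded by a linear combination of ancestor indicators, and the expected
  value of that combination telescopes to a constant times the summand of \<open>\<Phi>\<close>. Hence some tree
  is at least as good as the average.

  The finger starts at the root of that tree and not at \<open>x\<^sub>0\<close>, so the depth of \<open>x\<^sub>0\<close> has to be
  paid as well. Keys outside the range visited by the sequence can be given negligible weight,
  and the total weight of the visited range is at most exponential in \<open>\<Phi>\<close>, relative to the weight
  of \<open>x\<^sub>0\<close>; this makes the expected depth of \<open>x\<^sub>0\<close> linear in \<open>\<Phi>\<close>.
\<close>

subsection \<open>Ancestors and move costs in search trees\<close>

lemma ancestor_Leaf [simp]: "\<not> ancestor \<langle>\<rangle> u v"
  by (simp add: ancestor_def)

lemma ancestor_Node [simp]:
  "ancestor \<langle>l, x, r\<rangle> u v \<longleftrightarrow> u = x \<and> v \<in> set_tree \<langle>l, x, r\<rangle> \<or> ancestor l u v \<or> ancestor r u v"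
  by (auto simp: ancestor_def)

lemma ancestor_in_set_tree: "ancestor T u v \<Longrightarrow> u \<in> set_tree T \<and> v \<in> set_tree T"
  by (induction T) auto

lemma ancestor_bst_left: "bst \<langle>l, x, r\<rangle> \<Longrightarrow> ancestor l u v \<Longrightarrow> u < x \<and> v < x"
  using ancestor_in_set_tree[of l u v] by simp

lemma ancestor_bst_right: "bst \<langle>l, x, r\<rangle> \<Longrightarrow> ancestor r u v \<Longrightarrow> x < u \<and> x < v"
  using ancestor_in_set_tree[of r u v] by simp

lemma bst_left: "bst \<langle>l, x, r\<rangle> \<Longrightarrow> v \<in> set_tree \<langle>l, x, r\<rangle> \<Longrightarrow> v < x \<Longrightarrow> v \<in> set_tree l"
  by (force dest: less_asym)

lemma bst_right: "bst \<langle>l, x, r\<rangle> \<Longrightarrow> v \<in> set_tree \<langle>l, x, r\<rangle> \<Longrightarrow> x < v \<Longrightarrow> v \<in> set_tree r"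
  by (force dest: less_asym)

lemma finite_ancestors [simp]: "finite {u. ancestor T u v}"
  by (rule finite_subset[of _ "set_tree T"]) (auto dest: ancestor_in_set_tree)

lemma ancestors_eq:
  assumes "bst \<langle>l, x, r\<rangle>" "v \<in> set_tree \<langle>l, x, r\<rangle>"
  shows "{u. ancestor \<langle>l, x, r\<rangle> u v} =
    insert x (if v < x then {u. ancestor l u v} else if v = x then {} else {u. ancestor r u v})"
proof -
  have "v < x \<Longrightarrow> \<not> ancestor r u v" "x < v \<Longrightarrow> \<not> ancestor l u v"
    "\<not> ancestor l u x" "\<not> ancestor r u x" for u
    using ancestor_bst_left[OF assms(1)] ancestor_bst_right[OF assms(1)] less_asym by blast+
  then show ?thesis using assms by (auto simp: not_less_iff_gr_or_eq)
qed

lemma node_depth_Node: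
  assumes "bst \<langle>l, x, r\<rangle>" "v \<in> set_tree \<langle>l, x, r\<rangle>"
  shows "node_depth \<langle>l, x, r\<rangle> v =
    (if v < x then Suc (node_depth l v) else if v = x then 0 else Suc (node_depth r v))"
  using assms by auto

text \<open>The ancestors of \<open>v\<close> are the keys on its search path, one at each depth
  from 0 to that of \<open>v\<close>. Counting them turns depths into sums of indicators.\<close>

lemma card_ancestors:
  "bst T \<Longrightarrow> v \<in> set_tree T \<Longrightarrow> card {u. ancestor T u v} = Suc (node_depth T v)"
proof (induction T)
  case (Node l x r)
  have "x \<notin> {u. ancestor l u v}" "x \<notin> {u. ancestor r u v}"
    using Node.prems by (auto dest!: ancestor_in_set_tree)
  moreover have "v < x \<Longrightarrow> v \<in> set_tree l" "x < v \<Longrightarrow> v \<in> set_tree r"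
    using Node.prems by auto
  ultimately show ?case
    using Node unfolding ancestors_eq[OF Node.prems] node_depth_Node[OF Node.prems] by auto
qed simp

text \<open>The search paths of \<open>a \<le> b\<close> run together while the current key lies
  outside \<open>{a..b}\<close>. The first key inside this interval is their last common
  one.\<close>

lemma common_ancestors_eq:
  assumes "bst \<langle>l, x, r\<rangle>" "a \<in> set_tree \<langle>l, x, r\<rangle>" "b \<in> set_tree \<langle>l, x, r\<rangle>" "a \<le> b"
  shows "{u. ancestor \<langle>l, x, r\<rangle> u a} \<inter> {u. ancestor \<langle>l, x, r\<rangle> u b} =
    insert x (if b < x then {u. ancestor l u a} \<inter> {u. ancestor l u b}
      else if x < a then {u. ancestor r u a} \<inter> {u. ancestor r u b} else {})"
proof -
  have "\<not> (ancestor l u a \<and> ancestor r u b)" for u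
    using ancestor_bst_left[OF assms(1)] ancestor_bst_right[OF assms(1)] less_asym by blast
  then show ?thesis
    using assms(4) unfolding ancestors_eq[OF assms(1,2)] ancestors_eq[OF assms(1,3)] by auto
qed

text \<open>The common ancestors form an initial piece of a search path, so the deepest one has
  depth one less than their number. This supplies the maximum that \<open>ARG_MAX\<close> in
  \<open>lca\<close> needs.\<close>

lemma deepest_common_ancestor:
  "bst T \<Longrightarrow> a \<in> set_tree T \<Longrightarrow> b \<in> set_tree T \<Longrightarrow> a \<le> b \<Longrightarrow>
    \<exists>u \<in> {u. ancestor T u a} \<inter> {u. ancestor T u b}.
      Suc (node_depth T u) = card ({u. ancestor T u a} \<inter> {u. ancestor T u b}) \<and>
      (\<forall>v \<in> {u. ancestor T u a} \<inter> {u. ancestor T u b}. node_depth T v \<le> node_depth T u)"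
proof (induction T)
  case (Node l x r)
  note eq = common_ancestors_eq[OF Node.prems]
  \<comment> \<open>The descent into either subtree: passing from \<open>t\<close> to the whole tree
    raises every depth by one and adds \<open>x\<close> to the common ancestors, so the same
    \<open>u\<close> works.\<close>
  have child: ?case if IH: "\<exists>u \<in> {u. ancestor t u a} \<inter> {u. ancestor t u b}.
      Suc (node_depth t u) = card ({u. ancestor t u a} \<inter> {u. ancestor t u b}) \<and>
      (\<forall>v \<in> {u. ancestor t u a} \<inter> {u. ancestor t u b}. node_depth t v \<le> node_depth t u)"
    and eq: "{u. ancestor \<langle>l, x, r\<rangle> u a} \<inter> {u. ancestor \<langle>l, x, r\<rangle> u b} =
      insert x ({u. ancestor t u a} \<inter> {u. ancestor t u b})"
    and nd: "\<And>v. v \<in> set_tree t \<Longrightarrow> node_depth \<langle>l, x, r\<rangle> v = Suc (node_depth t v)"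
    and x: "x \<notin> set_tree t" for t
  proof -
    from IH obtain u where u: "ancestor t u a" "ancestor t u b"
      "Suc (node_depth t u) = card ({u. ancestor t u a} \<inter> {u. ancestor t u b})"
      "\<forall>v \<in> {u. ancestor t u a} \<inter> {u. ancestor t u b}. node_depth t v \<le> node_depth t u"
      by blast
    have ndu: "node_depth \<langle>l, x, r\<rangle> v = Suc (node_depth t v)" if "ancestor t v a" for v
      using that nd by (blast dest: ancestor_in_set_tree)
    show ?thesis unfolding eq
    proof (intro bexI[of _ u] conjI ballI)
      show "Suc (node_depth \<langle>l, x, r\<rangle> u) = card (insert x ({u. ancestor t u a} \<inter> {u. ancestor t u b}))"
        using u(3) ndu[OF u(1)] x by (subst card_insert_disjoint) (auto dest: ancestor_in_set_tree)
    next
      fix v assume "v \<in> insert x ({u. ancestor t u a} \<inter> {u. ancestor t u b})"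
      then show "node_depth \<langle>l, x, r\<rangle> v \<le> node_depth \<langle>l, x, r\<rangle> u"
        using u(4) ndu[OF u(1)] ndu[of v] by auto
    qed (use u in auto)
  qed
  consider "b < x" | "x < a" | "a \<le> x" "x \<le> b" using not_le by blast
  then show ?case
  proof cases
    case 1
    then have l: "a \<in> set_tree l" "b \<in> set_tree l"
      using Node.prems(2,3) bst_left[OF Node.prems(1)] le_less_trans[OF Node.prems(4)] by blast+
    show ?thesis
    proof (rule child[OF Node.IH(1)[OF _ l Node.prems(4)]])
      show "{u. ancestor \<langle>l, x, r\<rangle> u a} \<inter> {u. ancestor \<langle>l, x, r\<rangle> u b} =
          insert x ({u. ancestor l u a} \<inter> {u. ancestor l u b})"
        unfolding eq using 1 by (simp only: if_True)
    qed (use Node.prems(1) in auto)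
  next
    case 2
    then have r: "a \<in> set_tree r" "b \<in> set_tree r"
      using Node.prems(2,3) bst_right[OF Node.prems(1)] less_le_trans[OF _ Node.prems(4)] by blast+
    have "\<not> b < x" using 2 Node.prems(4) by auto
    show ?thesis
    proof (rule child[OF Node.IH(2)[OF _ r Node.prems(4)]])
      show "{u. ancestor \<langle>l, x, r\<rangle> u a} \<inter> {u. ancestor \<langle>l, x, r\<rangle> u b} =
          insert x ({u. ancestor r u a} \<inter> {u. ancestor r u b})"
        unfolding eq using 2 \<open>\<not> b < x\<close> by (simp only: if_True if_False)
      show "node_depth \<langle>l, x, r\<rangle> v = Suc (node_depth r v)" if "v \<in> set_tree r" for v
        using that Node.prems(1) by (auto dest: less_asym)
    qed (use Node.prems(1) in auto)
  next
    case 3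
    then show ?thesis unfolding eq by auto
  qed
qed simp

section \<open>Lowest common ancestors and the move cost\<close>

lemma lca_commute: "lca T a b = lca T b a"
  by (simp add: lca_def conj_commute)

lemma move_cost_commute: "move_cost T a b = move_cost T b a"
  by (simp add: move_cost_def lca_commute[of T a])

lemma card_common_ancestors:
  assumes "bst T" "a \<in> set_tree T" "b \<in> set_tree T"
  shows "card ({u. ancestor T u a} \<inter> {u. ancestor T u b}) = Suc (node_depth T (lca T a b))"
  using assms
proof (induction a b rule: linorder_wlog)
  case (le a b)
  then obtain u where u: "ancestor T u a \<and> ancestor T u b"
      "Suc (node_depth T u) = card ({u. ancestor T u a} \<inter> {u. ancestor T u b})"
      "\<And>v. ancestor T v a \<and> ancestor T v b \<Longrightarrow> node_depth T v \<le> node_depth T u"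
    using deepest_common_ancestor[of T a b] by auto
  \<comment> \<open>The rules for a maximum in the naturals ask for a strict upper bound on the
    depths; \<open>Suc (node_depth T u)\<close> is one.\<close>
  have "node_depth T u \<le> node_depth T (lca T a b)"
    unfolding lca_def by (rule arg_max_nat_le[of _ u _ "Suc (node_depth T u)"]) (use u(1,3) in \<open>auto simp: less_Suc_eq_le\<close>)
  moreover have "node_depth T (lca T a b) \<le> node_depth T u"
    unfolding lca_def
    by (rule u(3), rule arg_max_natI[of _ u _ "Suc (node_depth T u)"]) (use u(1,3) in \<open>auto simp: less_Suc_eq_le\<close>)
  ultimately show ?case using u(2) by simp
next
  case (sym a b)
  then show ?case by (simp add: lca_commute[of T b] Int_commute)
qed

text \<open>The cost is the size of the symmetric difference of the two ancestor sets; the offsets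
  between depth and number of ancestors cancel.\<close>

lemma move_cost_eq_card:
  assumes "bst T" "a \<in> set_tree T" "b \<in> set_tree T"
  shows "move_cost T a b = int (card {u. ancestor T u a}) + int (card {u. ancestor T u b})
    - 2 * int (card ({u. ancestor T u a} \<inter> {u. ancestor T u b}))"
  unfolding move_cost_def card_ancestors[OF assms(1,2)] card_ancestors[OF assms(1,3)]
    card_common_ancestors[OF assms] by simp

lemma depth_lca_le:
  assumes "bst T" "a \<in> set_tree T" "b \<in> set_tree T"
  shows "node_depth T (lca T a b) \<le> node_depth T a" "node_depth T (lca T a b) \<le> node_depth T b"
proof -
  have "card ({u. ancestor T u a} \<inter> {u. ancestor T u b}) \<le> card {u. ancestor T u a}"
    "card ({u. ancestor T u a} \<inter> {u. ancestor T u b}) \<le> card {u. ancestor T u b}"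
    by (intro card_mono; simp)+
  then show "node_depth T (lca T a b) \<le> node_depth T a" "node_depth T (lca T a b) \<le> node_depth T b"
    unfolding card_ancestors[OF assms(1,2)] card_ancestors[OF assms(1,3)]
      card_common_ancestors[OF assms] by simp_all
qed

text \<open>The keys of a subtree are an interval of the keys of the tree, so the subtree rooted at
  \<open>k\<close> contains with \<open>b\<close> everything between \<open>k\<close> and
  \<open>b\<close>.\<close>

lemma ancestor_between:
  "bst T \<Longrightarrow> ancestor T k b \<Longrightarrow> a \<in> set_tree T \<Longrightarrow> min k b \<le> a \<Longrightarrow> a \<le> max k b \<Longrightarrow> ancestor T k a"
proof (induction T)
  case (Node l x r)
  have "ancestor l k b \<Longrightarrow> k < x \<and> b < x" "ancestor r k b \<Longrightarrow> x < k \<and> x < b"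
    using Node.prems(1) by (auto dest: ancestor_in_set_tree)
  then consider "k = x" | "ancestor l k b" "a < x" | "ancestor r k b" "x < a"
    using Node.prems by (auto simp: min_def max_def split: if_splits)
  then show ?case
  proof cases
    case 2
    then have "a \<in> set_tree l" using Node.prems bst_left by blast
    then show ?thesis using 2 Node by simp
  next
    case 3
    then have "a \<in> set_tree r" using Node.prems bst_right by blast
    then show ?thesis using 3 Node by simp
  qed (use Node.prems in simp)
qed simp

lemma move_cost_self:
  assumes "bst T" "a \<in> set_tree T" shows "move_cost T a a = 0"
  using move_cost_eq_card[OF assms assms(2)] by simp

lemma ancestor_refl: "v \<in> set_tree T \<Longrightarrow> ancestor T v v"
  by (induction T) auto

lemma ancestor_antisym: "bst T \<Longrightarrow> ancestor T u v \<Longrightarrow> ancestor T v u \<Longrightarrow> u = v"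
proof (induction T)
  case (Node l x r)
  have *: "\<not> ancestor l x y" "\<not> ancestor l y x" "\<not> ancestor r x y" "\<not> ancestor r y x"
    "\<not> (ancestor l u v \<and> ancestor r v u)" "\<not> (ancestor r u v \<and> ancestor l v u)" for y
    using ancestor_bst_left[OF Node.prems(1)] ancestor_bst_right[OF Node.prems(1)] less_asym by blast+
  show ?case using Node.prems(2,3) Node.IH Node.prems(1) * by auto
qed simp

text \<open>If the cost were not positive, the two ancestor sets would coincide, and
  \<open>a\<close> and \<open>b\<close> would be ancestors of each other. A positive cost can absorb
  additive constants.\<close>

lemma move_cost_pos:
  assumes "bst T" "a \<in> set_tree T" "b \<in> set_tree T" "a \<noteq> b"
  shows "1 \<le> move_cost T a b"
proof (rule ccontr)
  let ?A = "{u. ancestor T u a}" and ?B = "{u. ancestor T u b}"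
  assume "\<not> 1 \<le> move_cost T a b"
  moreover have "card (?A \<inter> ?B) \<le> card ?A" "card (?A \<inter> ?B) \<le> card ?B"
    by (intro card_mono; simp)+
  ultimately have "card (?A \<inter> ?B) = card ?A" "card (?A \<inter> ?B) = card ?B"
    unfolding move_cost_eq_card[OF assms(1-3)] by linarith+
  then have "?A \<inter> ?B = ?A" "?A \<inter> ?B = ?B"
    by (intro card_subset_eq; simp)+
  then have "ancestor T a b" "ancestor T b a"
    using ancestor_refl[OF assms(2)] ancestor_refl[OF assms(3)] by (metis IntE mem_Collect_eq)+
  then show False using ancestor_antisym assms by blast
qed

subsection \<open>A tree that is at least as good as the average\<close>

text \<open>
  \<open>k\<close> is an ancestor of \<open>v\<close> in the random tree iff \<open>k\<close> is the first key between \<open>k\<close> and \<open>v\<close> to be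
  chosen as a root.
\<close>

definition anc_prob :: "(nat \<Rightarrow> real) \<Rightarrow> nat \<Rightarrow> nat \<Rightarrow> real" where
  "anc_prob w k v = w k / sum w {min k v..max k v}"

lemma sum_of_bool_restrict:
  fixes f :: "nat \<Rightarrow> nat \<Rightarrow> real"
  assumes "finite I" "J \<subseteq> I" "\<And>k v. k \<in> I \<Longrightarrow> v \<in> I \<Longrightarrow> P k v \<longleftrightarrow> k \<in> J \<and> v \<in> J"
  shows "(\<Sum>(k, v)\<in>I \<times> I. of_bool (P k v) * f k v) = (\<Sum>(k, v)\<in>J \<times> J. f k v)"
proof (rule sum.mono_neutral_cong_right)
  have "P k v" if "k \<in> J" "v \<in> J" for k v using that assms by blast
  then show "\<And>z. z \<in> J \<times> J \<Longrightarrow> (case z of (k, v) \<Rightarrow> of_bool (P k v) * f k v) = (case z of (k, v) \<Rightarrow> f k v)"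
    by auto
qed (use assms in auto)

text \<open>Conditioning on the root \<open>x\<close>: if \<open>x\<close> lies between
  \<open>k\<close> and \<open>v\<close>, the event is decided and occurs only for
  \<open>x = k\<close>. Otherwise both keys fall into the same subtree, where the probability is
  given by the same formula.\<close>

lemma anc_prob_average:
  assumes pos: "\<And>k. k \<in> {l..<h} \<Longrightarrow> 0 < w k" and kv: "k \<in> {l..<h}" "v \<in> {l..<h}"
  shows "(\<Sum>x\<in>{l..<h}. w x * (of_bool (k = x) + of_bool (k < x \<and> v < x) * anc_prob w k v
      + of_bool (x < k \<and> x < v) * anc_prob w k v)) = sum w {l..<h} * anc_prob w k v"
proof -
  let ?p = "anc_prob w k v" and ?J = "{min k v..max k v}"
  have J: "?J \<subseteq> {l..<h}" using kv by auto
  have "0 < sum w ?J" using J by (intro sum_pos pos) auto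
  then have wk: "w k = ?p * sum w ?J" by (simp add: anc_prob_def)
  have "(\<Sum>x\<in>{l..<h}. w x * (of_bool (k = x) + of_bool (k < x \<and> v < x) * ?p + of_bool (x < k \<and> x < v) * ?p))
      = (\<Sum>x\<in>{l..<h}. w x * of_bool (k = x) + (w x * ?p - w x * of_bool (x \<in> ?J) * ?p))"
    by (intro sum.cong refl) (auto simp: algebra_simps min_def max_def)
  also have "\<dots> = (\<Sum>x\<in>{l..<h}. w x * of_bool (k = x)) + (sum w {l..<h} * ?p - (\<Sum>x\<in>{l..<h}. w x * of_bool (x \<in> ?J)) * ?p)"
    unfolding sum.distrib sum_subtractf sum_distrib_right ..
  also have "(\<Sum>x\<in>{l..<h}. w x * of_bool (k = x)) = w k"
    using kv by (simp add: of_bool_def if_distrib sum.If_cases cong: if_cong)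
  also have "(\<Sum>x\<in>{l..<h}. w x * of_bool (x \<in> ?J)) = sum w ?J"
    by (rule sum.mono_neutral_cong_right) (use J in auto)
  finally show ?thesis using wk by (simp add: algebra_simps)
qed

text \<open>The expectation is a weighted mean over the choices of the root, so some root does not
  exceed it; the argument is repeated in both subtrees. The coefficients \<open>g\<close> may have
  any sign.\<close>

lemma ex_bst_le_average:
  fixes w :: "nat \<Rightarrow> real" and g :: "nat \<Rightarrow> nat \<Rightarrow> real"
  assumes "\<And>k. k \<in> {l..<h} \<Longrightarrow> 0 < w k"
  shows "\<exists>T. bst T \<and> set_tree T = {l..<h} \<and>
    (\<Sum>(k, v)\<in>{l..<h} \<times> {l..<h}. of_bool (ancestor T k v) * g k v)
      \<le> (\<Sum>(k, v)\<in>{l..<h} \<times> {l..<h}. anc_prob w k v * g k v)"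
  using assms
proof (induction "h - l" arbitrary: l h rule: less_induct)
  case less
  show ?case
  proof (cases "l < h")
    case False
    then show ?thesis by (intro exI[of _ "\<langle>\<rangle>"]) simp
  next
    case True
    let ?I = "{l..<h}" and ?p = "anc_prob w"
    \<comment> \<open>\<open>q x k v\<close> is the probability that \<open>k\<close> is an ancestor
      of \<open>v\<close> once the root is \<open>x\<close>, \<open>Q x\<close> the corresponding
      conditional expectation, and \<open>G\<close> the unconditional one.\<close>
    define q where "q x k v = of_bool (k = x) + of_bool (k < x \<and> v < x) * ?p k v
      + of_bool (x < k \<and> x < v) * ?p k v" for x k v
    define Q where "Q x = (\<Sum>(k, v)\<in>?I \<times> ?I. q x k v * g k v)" for x
    define G where "G = (\<Sum>(k, v)\<in>?I \<times> ?I. ?p k v * g k v)"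
    have "(\<Sum>x\<in>?I. w x * Q x) = (\<Sum>(k, v)\<in>?I \<times> ?I. (\<Sum>x\<in>?I. w x * q x k v) * g k v)"
      unfolding Q_def sum_distrib_left sum_distrib_right case_prod_unfold
      by (subst sum.swap) (simp add: mult.assoc)
    also have "\<dots> = (\<Sum>(k, v)\<in>?I \<times> ?I. sum w ?I * ?p k v * g k v)"
      unfolding q_def using anc_prob_average[OF less.prems, of l h] by (intro sum.cong refl) auto
    also have "\<dots> = sum w ?I * G"
      unfolding G_def sum_distrib_left case_prod_unfold by (simp add: mult.assoc)
    also have "\<dots> = (\<Sum>x\<in>?I. w x * G)"
      by (rule sum_distrib_right)
    finally have avg: "(\<Sum>x\<in>?I. w x * Q x) = (\<Sum>x\<in>?I. w x * G)" .
    have "\<exists>x\<in>?I. Q x \<le> G"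
    proof (rule ccontr)
      assume "\<not> ?thesis"
      then have "(\<Sum>x\<in>?I. w x * G) < (\<Sum>x\<in>?I. w x * Q x)"
        using True less.prems by (intro sum_strict_mono) (auto simp: not_le)
      then show False using avg by simp
    qed
    then obtain x where x: "x \<in> ?I" "Q x \<le> G" by blast
    let ?L = "{l..<x}" and ?R = "{Suc x..<h}"
    have "\<exists>T. bst T \<and> set_tree T = ?L \<and>
      (\<Sum>(k, v)\<in>?L \<times> ?L. of_bool (ancestor T k v) * g k v) \<le> (\<Sum>(k, v)\<in>?L \<times> ?L. ?p k v * g k v)"
      by (rule less.hyps) (use x less.prems in auto)
    then obtain L where L: "bst L" "set_tree L = ?L"
      "(\<Sum>(k, v)\<in>?L \<times> ?L. of_bool (ancestor L k v) * g k v) \<le> (\<Sum>(k, v)\<in>?L \<times> ?L. ?p k v * g k v)"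
      by blast
    have "\<exists>T. bst T \<and> set_tree T = ?R \<and>
      (\<Sum>(k, v)\<in>?R \<times> ?R. of_bool (ancestor T k v) * g k v) \<le> (\<Sum>(k, v)\<in>?R \<times> ?R. ?p k v * g k v)"
      by (rule less.hyps) (use x less.prems in auto)
    then obtain R where R: "bst R" "set_tree R = ?R"
      "(\<Sum>(k, v)\<in>?R \<times> ?R. of_bool (ancestor R k v) * g k v) \<le> (\<Sum>(k, v)\<in>?R \<times> ?R. ?p k v * g k v)"
      by blast
    define T where "T = \<langle>L, x, R\<rangle>"
    have bst: "bst T" and set: "set_tree T = ?I"
      using L R x by (auto simp: T_def)
    have restrict: "(\<Sum>(k, v)\<in>?I \<times> ?I. of_bool (k < x \<and> v < x) * f k v) = (\<Sum>(k, v)\<in>?L \<times> ?L. f k v)"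
      "(\<Sum>(k, v)\<in>?I \<times> ?I. of_bool (x < k \<and> x < v) * f k v) = (\<Sum>(k, v)\<in>?R \<times> ?R. f k v)"
      for f :: "nat \<Rightarrow> nat \<Rightarrow> real"
      using x by (intro sum_of_bool_restrict; auto)+
    \<comment> \<open>The same decomposition as for \<open>q\<close>, with indicators for the chosen
      subtrees in place of probabilities; this makes the two sums comparable term by term.\<close>
    have anc: "of_bool (ancestor T k v) = (of_bool (k = x)
        + of_bool (k < x \<and> v < x) * of_bool (ancestor L k v)
        + of_bool (x < k \<and> x < v) * of_bool (ancestor R k v) :: real)"
      if "k \<in> ?I" "v \<in> ?I" for k v
    proof -
      have "v \<in> set_tree T" using that set by simp
      moreover have "ancestor L k v \<Longrightarrow> k < x \<and> v < x" "ancestor R k v \<Longrightarrow> x < k \<and> x < v"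
        using ancestor_bst_left[of L x R k v] ancestor_bst_right[of L x R k v] bst unfolding T_def by blast+
      ultimately show ?thesis unfolding T_def by auto
    qed
    have "(\<Sum>(k, v)\<in>?I \<times> ?I. of_bool (ancestor T k v) * g k v)
      = (\<Sum>(k, v)\<in>?I \<times> ?I. of_bool (k = x) * g k v
          + of_bool (k < x \<and> v < x) * (of_bool (ancestor L k v) * g k v)
          + of_bool (x < k \<and> x < v) * (of_bool (ancestor R k v) * g k v))"
    proof (intro sum.cong refl)
      fix z assume "z \<in> ?I \<times> ?I"
      then obtain k v where z: "z = (k, v)" "k \<in> ?I" "v \<in> ?I" by blast
      show "(case z of (k, v) \<Rightarrow> of_bool (ancestor T k v) * g k v) =
          (case z of (k, v) \<Rightarrow> of_bool (k = x) * g k v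
            + of_bool (k < x \<and> v < x) * (of_bool (ancestor L k v) * g k v)
            + of_bool (x < k \<and> x < v) * (of_bool (ancestor R k v) * g k v))"
        unfolding z(1) prod.case anc[OF z(2,3)] distrib_right mult.assoc ..
    qed
    also have "\<dots> = (\<Sum>(k, v)\<in>?I \<times> ?I. of_bool (k = x) * g k v)
        + (\<Sum>(k, v)\<in>?L \<times> ?L. of_bool (ancestor L k v) * g k v)
        + (\<Sum>(k, v)\<in>?R \<times> ?R. of_bool (ancestor R k v) * g k v)"
      unfolding restrict[symmetric] by (simp add: case_prod_unfold sum.distrib)
    also have "\<dots> \<le> (\<Sum>(k, v)\<in>?I \<times> ?I. of_bool (k = x) * g k v)
        + (\<Sum>(k, v)\<in>?L \<times> ?L. ?p k v * g k v) + (\<Sum>(k, v)\<in>?R \<times> ?R. ?p k v * g k v)"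
      using L(3) R(3) by simp
    also have "\<dots> = Q x"
      unfolding restrict[symmetric] Q_def q_def
      by (simp add: case_prod_unfold algebra_simps sum.distrib)
    finally show ?thesis using x(2) bst set unfolding G_def by (intro exI[of _ T]) auto
  qed
qed

subsection \<open>Telescoping logarithmic bounds\<close>

text \<open>This is \<open>ln t \<le> t - 1\<close> at \<open>t = S / (S + w)\<close>; the
  right-hand side telescopes when weights are added one at a time.\<close>

lemma divide_le_ln_diff:
  fixes S w :: real
  assumes "0 < S" "0 < w"
  shows "w / (S + w) \<le> ln (S + w) - ln S"
proof -
  have "ln (S / (S + w)) \<le> S / (S + w) - 1" using assms by (intro ln_le_minus_one) simp
  also have "\<dots> = - (w / (S + w))" using assms by (simp add: field_simps)
  finally show ?thesis using assms by (simp add: ln_div)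
qed

text \<open>The ratio \<open>?r\<close> is the factor by which \<open>(S + D) / S\<close> changes
  when \<open>w\<close> is added to \<open>S\<close>. The left-hand side is at most
  \<open>1 - ?r\<close>, hence at most \<open>- ln ?r\<close>.\<close>

lemma divide_diff_le_ln_diff:
  fixes S D w :: real
  assumes "0 < S" "0 < w" "0 \<le> D"
  shows "w / (S + w) - w / (S + w + D) \<le> (ln (S + D) - ln S) - (ln (S + w + D) - ln (S + w))"
proof -
  let ?r = "S * (S + w + D) / ((S + D) * (S + w))"
  have "ln ?r \<le> ?r - 1" using assms by (intro ln_le_minus_one) (simp add: add_pos_nonneg)
  moreover have "ln ?r = ln S + ln (S + w + D) - ln (S + D) - ln (S + w)"
    using assms by (simp add: ln_div ln_mult add_pos_nonneg)
  moreover have "1 - ?r = w * D / ((S + D) * (S + w))"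
    using assms by (simp add: divide_simps add_pos_nonneg) (simp add: algebra_simps)
  moreover have "w / (S + w) - w / (S + w + D) = w * D / ((S + w + D) * (S + w))"
    using assms by (simp add: divide_simps add_pos_nonneg) (simp add: algebra_simps)
  moreover have "w * D / ((S + w + D) * (S + w)) \<le> w * D / ((S + D) * (S + w))"
    using assms by (intro divide_left_mono mult_right_mono mult_pos_pos) (simp_all add: add_pos_nonneg)
  ultimately show ?thesis by linarith
qed

section \<open>Telescoped sums over intervals of keys\<close>

context
  fixes w :: "nat \<Rightarrow> real" and l h :: nat
  assumes pos: "\<And>k. k \<in> {l..h} \<Longrightarrow> 0 < w k"
begin

lemma wsum_pos: "l \<le> a \<Longrightarrow> a \<le> b \<Longrightarrow> b \<le> h \<Longrightarrow> 0 < sum w {a..b}"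
  by (rule sum_pos) (auto intro: pos)

lemma wsum_mono: "l \<le> a \<Longrightarrow> a \<le> c \<Longrightarrow> d \<le> b \<Longrightarrow> b \<le> h \<Longrightarrow> sum w {c..d} \<le> sum w {a..b}"
  by (rule sum_mono2) (auto intro!: less_imp_le[OF pos])

text \<open>The term \<open>k = a\<close> equals 1; every later one is at most the increase of the
  logarithm of the partial sum.\<close>

lemma sum_right_le_ln:
  assumes "a \<le> b" "l \<le> a" "b \<le> h"
  shows "(\<Sum>k = a..b. w k / sum w {a..k}) \<le> 1 + (ln (sum w {a..b}) - ln (w a))"
  using assms
proof (induction b rule: dec_induct)
  case base
  then show ?case using pos[of a] by simp
next
  case (step b)
  have "w (Suc b) / (sum w {a..b} + w (Suc b)) \<le> ln (sum w {a..b} + w (Suc b)) - ln (sum w {a..b})"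
    using step by (intro divide_le_ln_diff wsum_pos pos) auto
  then show ?case using step by simp
qed

lemma sum_left_le_ln:
  assumes "a \<le> b" "l \<le> a" "b \<le> h"
  shows "(\<Sum>k = a..b. w k / sum w {k..b}) \<le> 1 + (ln (sum w {a..b}) - ln (w b))"
  using assms
proof (induction a rule: inc_induct)
  case base
  then show ?case using pos[of b] by simp
next
  case (step a)
  have *: "(\<Sum>k = a..b. f k) = f a + (\<Sum>k = Suc a..b. f k)" for f :: "nat \<Rightarrow> real"
    using step by (simp add: sum.atLeast_Suc_atMost)
  have "w a / (sum w {Suc a..b} + w a) \<le> ln (sum w {Suc a..b} + w a) - ln (sum w {Suc a..b})"
    using step by (intro divide_le_ln_diff wsum_pos pos) auto
  then show ?case using step *[of "\<lambda>k. w k / sum w {k..b}"] *[of w] by (simp add: add.commute)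
qed

text \<open>Keys are added below \<open>a\<close> one by one, with \<open>S\<close> the weight from
  the newest key up to \<open>a\<close> and \<open>D\<close> that of the keys after \<open>a\<close>
  up to \<open>b\<close>. The bounds telescope to the total decrease of
  \<open>ln ((S + D) / S)\<close>, which never exceeds its initial value, whatever the weight below
  \<open>a\<close>.\<close>

lemma sum_below_le_ln:
  assumes "c \<le> a" "a \<le> b" "l \<le> c" "b \<le> h"
  shows "(\<Sum>k = c..<a. w k / sum w {k..a} - w k / sum w {k..b})
    \<le> (ln (sum w {a..b}) - ln (w a)) - (ln (sum w {c..b}) - ln (sum w {c..a}))"
  using assms
proof (induction c rule: inc_induct)
  case base
  then show ?case by simp
next
  case (step c)
  let ?S = "sum w {Suc c..a}" and ?D = "sum w {Suc a..b}"
  have S: "sum w {c..a} = ?S + w c" "sum w {c..b} = ?S + w c + ?D" "sum w {Suc c..b} = ?S + ?D"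
    using step sum.ub_add_nat[of "Suc c" a w "b - a"] by (simp_all add: sum.atLeast_Suc_atMost)
  have "w c / (?S + w c) - w c / (?S + w c + ?D)
      \<le> (ln (?S + ?D) - ln ?S) - (ln (?S + w c + ?D) - ln (?S + w c))"
    using step by (intro divide_diff_le_ln_diff wsum_pos pos sum_nonneg less_imp_le[OF pos]) auto
  moreover have "(\<Sum>k = c..<a. w k / sum w {k..a} - w k / sum w {k..b})
      = (w c / sum w {c..a} - w c / sum w {c..b}) + (\<Sum>k = Suc c..<a. w k / sum w {k..a} - w k / sum w {k..b})"
    using step by (simp add: sum.atLeast_Suc_lessThan)
  ultimately show ?case using step S by simp
qed

text \<open>Mirror image of the previous estimate: keys are added above \<open>b\<close>, and
  \<open>D\<close> is the weight of the keys from \<open>a\<close> to just before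
  \<open>b\<close>.\<close>

lemma sum_above_le_ln:
  assumes "b \<le> c" "a \<le> b" "l \<le> a" "c \<le> h"
  shows "(\<Sum>k\<in>{b<..c}. w k / sum w {b..k} - w k / sum w {a..k})
    \<le> (ln (sum w {a..b}) - ln (w b)) - (ln (sum w {a..c}) - ln (sum w {b..c}))"
  using assms
proof (induction c rule: dec_induct)
  case base
  then show ?case by simp
next
  case (step c)
  let ?S = "sum w {b..c}" and ?D = "sum w {a..<b}"
  have S: "sum w {b..Suc c} = ?S + w (Suc c)" "sum w {a..Suc c} = ?S + w (Suc c) + ?D" "sum w {a..c} = ?S + ?D"
    using step sum.atLeastLessThan_concat[of a b "Suc c" w]
    by (simp_all add: atLeastLessThanSuc_atLeastAtMost)
  have "w (Suc c) / (?S + w (Suc c)) - w (Suc c) / (?S + w (Suc c) + ?D)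
      \<le> (ln (?S + ?D) - ln ?S) - (ln (?S + w (Suc c) + ?D) - ln (?S + w (Suc c)))"
    using step by (intro divide_diff_le_ln_diff wsum_pos pos sum_nonneg less_imp_le[OF pos]) auto
  moreover have "(\<Sum>k\<in>{b<..Suc c}. w k / sum w {b..k} - w k / sum w {a..k})
      = (w (Suc c) / sum w {b..Suc c} - w (Suc c) / sum w {a..Suc c})
        + (\<Sum>k\<in>{b<..c}. w k / sum w {b..k} - w k / sum w {a..k})"
    if "{b<..Suc c} = insert (Suc c) {b<..c}" unfolding that by simp
  moreover have "{b<..Suc c} = insert (Suc c) {b<..c}" using step by auto
  ultimately show ?case using step.IH step.prems unfolding S by linarith
qed

end

subsection \<open>Moves as linear functionals of the ancestor relation\<close>

definition edge_Phi :: "(nat \<Rightarrow> real) \<Rightarrow> nat \<Rightarrow> nat \<Rightarrow> real" where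
  "edge_Phi w a b = log 2 (sum w {min a b..max a b} / min (w a) (w b))"

lemma edge_Phi_commute: "edge_Phi w a b = edge_Phi w b a"
  by (simp add: edge_Phi_def min.commute max.commute)

text \<open>Two distinct endpoints both occur in the numerator, which is therefore at least twice
  the smaller weight.\<close>

lemma edge_Phi_ge_1:
  assumes "\<And>k. k \<in> {min a b..max a b} \<Longrightarrow> 0 < w k" "a \<noteq> b"
  shows "1 \<le> edge_Phi w a b"
proof -
  have ab: "0 < w a" "0 < w b" using assms(1) by auto
  have "2 * min (w a) (w b) \<le> w a + w b" by simp
  also have "\<dots> = sum w {a, b}" using assms(2) by simp
  also have "\<dots> \<le> sum w {min a b..max a b}"
    by (rule sum_mono2) (auto intro!: less_imp_le[OF assms(1)])
  finally have "2 \<le> sum w {min a b..max a b} / min (w a) (w b)"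
    using ab by (simp add: pos_le_divide_eq)
  then show ?thesis unfolding edge_Phi_def by (simp add: le_log_iff)
qed

lemma edge_Phi_self: "0 < w a \<Longrightarrow> edge_Phi w a a = 0"
  by (simp add: edge_Phi_def)

lemma edge_Phi_nonneg:
  assumes "\<And>k. k \<in> {min a b..max a b} \<Longrightarrow> 0 < w k"
  shows "0 \<le> edge_Phi w a b"
  using edge_Phi_ge_1[of a b w] edge_Phi_self[of w a] assms by (cases "a = b") fastforce+

lemma wsum_eq_powr_edge_Phi:
  assumes "\<And>k. k \<in> {min a b..max a b} \<Longrightarrow> 0 < w k"
  shows "sum w {min a b..max a b} = 2 powr edge_Phi w a b * min (w a) (w b)"
proof -
  have "0 < w a" "0 < w b" using assms by auto
  moreover have "0 < sum w {min a b..max a b}" by (rule sum_pos) (auto intro: assms)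
  ultimately show ?thesis unfolding edge_Phi_def by (simp add: powr_log_cancel)
qed

section \<open>Depths and moves as sums of ancestor indicators\<close>

lemma card_eq_sum_of_bool:
  assumes "finite I" "A \<subseteq> I"
  shows "real (card A) = (\<Sum>k\<in>I. of_bool (k \<in> A))"
  using assms by (simp add: Int_absorb1 Collect_mem_eq)

lemma sum_prod_of_bool_eq:
  fixes M :: "nat \<Rightarrow> nat \<Rightarrow> real"
  assumes "a \<in> {1..n}"
  shows "(\<Sum>(k, v)\<in>{1..n} \<times> {1..n}. M k v * (of_bool (v = a) * c k)) = (\<Sum>k = 1..n. M k a * c k)"
proof -
  have "(\<Sum>v = 1..n. M k v * (of_bool (v = a) * c k)) = M k a * c k" for k
  proof -
    have "(\<Sum>v = 1..n. M k v * (of_bool (v = a) * c k)) = (\<Sum>v = 1..n. if v = a then M k v * c k else 0)"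
      by (intro sum.cong) auto
    then show ?thesis using assms by simp
  qed
  then show ?thesis by (simp add: sum.cartesian_product[symmetric])
qed

lemma ancestors_subset: "T \<in> bsts n \<Longrightarrow> {u. ancestor T u a} \<subseteq> {1..n}"
  by (auto simp: bsts_def dest!: ancestor_in_set_tree)

text \<open>
  The negative coefficients use that an ancestor of \<open>b\<close> to the left of \<open>a \<le> b\<close> is also an ancestor
  of \<open>a\<close>, and symmetrically. They are essential: without them the expectation would be governed by
  the total weight instead of the weight between \<open>a\<close> and \<open>b\<close>.
\<close>

lemma move_cost_le_functional:
  assumes T: "T \<in> bsts n" and ab: "a \<in> {1..n}" "b \<in> {1..n}" "a \<le> b"
  shows "real_of_int (move_cost T a b) \<le>
    (\<Sum>k = 1..n. of_bool (ancestor T k a) * (if k \<le> b then 1 else -1)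
      + of_bool (ancestor T k b) * (if a \<le> k then 1 else -1))"
proof -
  let ?A = "{u. ancestor T u a}" and ?B = "{u. ancestor T u b}"
  have bst: "bst T" "a \<in> set_tree T" "b \<in> set_tree T"
    using T ab by (auto simp: bsts_def)
  have "real_of_int (move_cost T a b) = real (card ?A) + real (card ?B) - 2 * real (card (?A \<inter> ?B))"
    unfolding move_cost_eq_card[OF bst] by simp
  also have "\<dots> = (\<Sum>k = 1..n. of_bool (k \<in> ?A) + of_bool (k \<in> ?B) - 2 * of_bool (k \<in> ?A \<inter> ?B))"
    using ancestors_subset[OF T]
    by (subst (1 2 3) card_eq_sum_of_bool[of "{1..n}"])
      (auto simp only: sum.distrib sum_subtractf sum_distrib_left finite_atLeastAtMost)
  also have "\<dots> \<le> (\<Sum>k = 1..n. of_bool (ancestor T k a) * (if k \<le> b then 1 else -1)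
      + of_bool (ancestor T k b) * (if a \<le> k then 1 else -1))"
  \<comment> \<open>For \<open>k < a\<close>, ancestry of \<open>b\<close> implies ancestry of
    \<open>a\<close>, and both sides become the difference of the two indicators;
    \<open>b < k\<close> is symmetric. For \<open>k\<close> between \<open>a\<close> and
    \<open>b\<close>, the term with factor -2 is dropped.\<close>
  proof (rule sum_mono)
    fix k assume "k \<in> {1..n}"
    have "ancestor T k a" if "ancestor T k b" "k < a"
      by (rule ancestor_between[OF bst(1) that(1) bst(2)]) (use that ab in auto)
    moreover have "ancestor T k b" if "ancestor T k a" "b < k"
      by (rule ancestor_between[OF bst(1) that(1) bst(3)]) (use that ab in auto)
    ultimately show "of_bool (k \<in> ?A) + of_bool (k \<in> ?B) - 2 * of_bool (k \<in> ?A \<inter> ?B)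
      \<le> of_bool (ancestor T k a) * (if k \<le> b then 1 else -1 :: real)
        + of_bool (ancestor T k b) * (if a \<le> k then 1 else -1)"
      using ab by auto
  qed
  finally show ?thesis .
qed

text \<open>The keys are split into those below \<open>a\<close>, from \<open>a\<close> to
  \<open>b\<close>, and above \<open>b\<close>. The opposite signs turn the outer parts into the
  differences estimated above, and the middle part consists of two sums over
  \<open>{a..b}\<close>.\<close>

lemma anc_prob_functional_le:
  assumes pos: "\<And>k. k \<in> {1..n} \<Longrightarrow> 0 < w k" and ab: "a \<in> {1..n}" "b \<in> {1..n}" "a < b"
  shows "(\<Sum>k = 1..n. anc_prob w k a * (if k \<le> b then 1 else -1)
      + anc_prob w k b * (if a \<le> k then 1 else -1)) \<le> 6 * edge_Phi w a b"
proof -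
  define f where "f = (\<lambda>k. anc_prob w k a * (if k \<le> b then 1 else -1) + anc_prob w k b * (if a \<le> k then 1 else -1))"
  define s m where "s = sum w {a..b}" and "m = min (w a) (w b)"
  note mono = wsum_mono[of 1 n w, OF pos] and wpos = wsum_pos[of 1 n w, OF pos]
  have w: "0 < w a" "0 < w b" "0 < s" using ab pos wpos[of a b] by (auto simp: s_def)
  have split: "{1..n} = {1..<a} \<union> ({a..b} \<union> {b<..n})" using ab by auto
  have "sum f {1..n} = sum f {1..<a} + (sum f {a..b} + sum f {b<..n})"
    unfolding split using ab by (subst sum.union_disjoint; (subst sum.union_disjoint)?) auto
  moreover have "sum f {1..<a} = (\<Sum>k = 1..<a. w k / sum w {k..a} - w k / sum w {k..b})"
    using ab by (intro sum.cong refl) (simp add: anc_prob_def f_def)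
  moreover have "sum f {a..b} = (\<Sum>k = a..b. w k / sum w {a..k}) + (\<Sum>k = a..b. w k / sum w {k..b})"
    unfolding sum.distrib[symmetric] using ab by (intro sum.cong refl) (simp add: anc_prob_def f_def)
  moreover have "sum f {b<..n} = (\<Sum>k\<in>{b<..n}. w k / sum w {b..k} - w k / sum w {a..k})"
    using ab by (intro sum.cong refl) (simp add: anc_prob_def f_def)
  moreover have "(\<Sum>k = 1..<a. w k / sum w {k..a} - w k / sum w {k..b})
    \<le> (ln s - ln (w a)) - (ln (sum w {1..b}) - ln (sum w {1..a}))"
    unfolding s_def by (rule sum_below_le_ln[of 1 n]) (use ab pos in auto)
  moreover have "ln (sum w {1..a}) \<le> ln (sum w {1..b})"
    using ab by (intro ln_mono mono wpos) auto
  moreover have "(\<Sum>k\<in>{b<..n}. w k / sum w {b..k} - w k / sum w {a..k})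
    \<le> (ln s - ln (w b)) - (ln (sum w {a..n}) - ln (sum w {b..n}))"
    unfolding s_def by (rule sum_above_le_ln[of 1 n]) (use ab pos in auto)
  moreover have "ln (sum w {b..n}) \<le> ln (sum w {a..n})"
    using ab by (intro ln_mono mono wpos) auto
  moreover have "(\<Sum>k = a..b. w k / sum w {a..k}) \<le> 1 + (ln s - ln (w a))"
    unfolding s_def by (rule sum_right_le_ln[of 1 n]) (use ab pos in auto)
  moreover have "(\<Sum>k = a..b. w k / sum w {k..b}) \<le> 1 + (ln s - ln (w b))"
    unfolding s_def by (rule sum_left_le_ln[of 1 n]) (use ab pos in auto)
  moreover have "ln m \<le> ln (w a)" "ln m \<le> ln (w b)"
    using w by (intro ln_mono; simp add: m_def)+
  \<comment> \<open>Each outer part gives one logarithmic term, the middle two such terms and the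
    constant 2. As \<open>ln 2 < 1\<close> and the summand of \<open>Phi\<close> is at least 1, this
    adds up to the factor 6.\<close>
  ultimately have le: "sum f {1..n} \<le> 2 + 4 * (ln s - ln m)" by argo
  have e1: "1 \<le> edge_Phi w a b" by (rule edge_Phi_ge_1) (use ab pos in auto)
  have "ln s - ln m = ln (s / m)" using w ln_divide_pos[of s m] by (simp add: m_def)
  also have "\<dots> = ln 2 * edge_Phi w a b" using ab by (simp add: edge_Phi_def log_def s_def m_def)
  also have "\<dots> \<le> 1 * edge_Phi w a b"
    by (rule mult_right_mono) (use e1 ln_2_less_1 in auto)
  finally have "sum f {1..n} \<le> 6 * edge_Phi w a b" using le e1 by argo
  then show ?thesis by (simp add: f_def)
qed

text \<open>The coefficients \<open>g\<close> are fixed before the tree. Hence the functionals of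
  all moves can be added, and the averaging argument yields one tree for the whole sequence.\<close>

lemma ex_functional_move_cost:
  assumes pos: "\<And>k. k \<in> {1..n} \<Longrightarrow> 0 < w k" and ab: "a \<in> {1..n}" "b \<in> {1..n}"
  shows "\<exists>g. (\<forall>T\<in>bsts n. real_of_int (move_cost T a b) \<le>
      (\<Sum>(k, v)\<in>{1..n} \<times> {1..n}. of_bool (ancestor T k v) * g k v)) \<and>
    (\<Sum>(k, v)\<in>{1..n} \<times> {1..n}. anc_prob w k v * g k v) \<le> 6 * edge_Phi w a b"
  using ab
proof (induction a b rule: linorder_wlog)
  case (sym a b)
  then show ?case by (simp only: move_cost_commute[of _ b] edge_Phi_commute[of _ b])
next
  case (le a b)
  show ?case
  proof (cases "a = b")
    case True
    then show ?thesis
      using le pos[of a] edge_Phi_self[of w a]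
      by (intro exI[of _ "\<lambda>_ _. 0"]) (auto simp: bsts_def move_cost_self)
  next
    case False
    let ?g = "\<lambda>k v. of_bool (v = a) * (if k \<le> b then 1 else -1) + of_bool (v = b) * (if a \<le> k then 1 else -1) :: real"
    have eq: "(\<Sum>(k, v)\<in>{1..n} \<times> {1..n}. M k v * ?g k v) =
      (\<Sum>k = 1..n. M k a * (if k \<le> b then 1 else -1) + M k b * (if a \<le> k then 1 else -1))"
      for M :: "nat \<Rightarrow> nat \<Rightarrow> real"
      unfolding sum.distrib distrib_left case_prod_unfold
      using sum_prod_of_bool_eq[OF le(2), of M "\<lambda>k. if k \<le> b then 1 else -1"]
        sum_prod_of_bool_eq[OF le(3), of M "\<lambda>k. if a \<le> k then 1 else -1"]
      by (simp only: case_prod_unfold)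
    show ?thesis
      using move_cost_le_functional[OF _ le(2,3,1)] anc_prob_functional_le[OF pos le(2,3)] False le(1)
      by (intro exI[of _ ?g]) (simp only: eq, auto)
  qed
qed

lemma depth_eq_functional:
  assumes T: "T \<in> bsts n" and a: "a \<in> {1..n}"
  shows "real (node_depth T a) + 1 = (\<Sum>k = 1..n. of_bool (ancestor T k a))"
proof -
  have "real (node_depth T a) + 1 = real (card {u. ancestor T u a})"
    using card_ancestors[of T a] T a by (simp add: bsts_def)
  also have "\<dots> = (\<Sum>k = 1..n. of_bool (k \<in> {u. ancestor T u a}))"
    by (rule card_eq_sum_of_bool) (use ancestors_subset[OF T] in auto)
  finally show ?thesis by simp
qed

text \<open>This is the expected number of ancestors of \<open>a\<close>. The sums to the left and
  to the right both contain the term 1 for \<open>a\<close> itself, so only one of the two constants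
  remains.\<close>

lemma sum_anc_prob_le:
  assumes pos: "\<And>k. k \<in> {1..n} \<Longrightarrow> 0 < w k" and a: "a \<in> {1..n}"
  shows "(\<Sum>k = 1..n. anc_prob w k a)
    \<le> 1 + (ln (sum w {1..a}) - ln (w a)) + (ln (sum w {a..n}) - ln (w a))"
proof -
  have "(\<Sum>k = 1..n. anc_prob w k a) = (\<Sum>k = 1..a. anc_prob w k a) + (\<Sum>k = Suc a..n. anc_prob w k a)"
    using a sum.ub_add_nat[of 1 a "\<lambda>k. anc_prob w k a" "n - a"] by simp
  moreover have "(\<Sum>k = a..n. anc_prob w k a) = 1 + (\<Sum>k = Suc a..n. anc_prob w k a)"
    using a pos[of a] by (simp add: sum.atLeast_Suc_atMost anc_prob_def)
  moreover have "(\<Sum>k = 1..a. anc_prob w k a) = (\<Sum>k = 1..a. w k / sum w {k..a})"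
    "(\<Sum>k = a..n. anc_prob w k a) = (\<Sum>k = a..n. w k / sum w {a..k})"
    by (intro sum.cong refl; simp add: anc_prob_def)+
  moreover have "(\<Sum>k = 1..a. w k / sum w {k..a}) \<le> 1 + (ln (sum w {1..a}) - ln (w a))"
    by (rule sum_left_le_ln[of 1 n]) (use a pos in auto)
  moreover have "(\<Sum>k = a..n. w k / sum w {a..k}) \<le> 1 + (ln (sum w {a..n}) - ln (w a))"
    by (rule sum_right_le_ln[of 1 n]) (use a pos in auto)
  ultimately show ?thesis by linarith
qed

subsection \<open>Sums along a search sequence\<close>

text \<open>The common shape of \<open>Phi\<close> and \<open>lazy_finger_cost\<close>, made
  available for induction on the list with a varying start.\<close>

definition path_sum :: "('a \<Rightarrow> 'a \<Rightarrow> 'b::comm_monoid_add) \<Rightarrow> 'a \<Rightarrow> 'a list \<Rightarrow> 'b" where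
  "path_sum f x X = (\<Sum>i = 1..length X. f ((x # X) ! (i - 1)) ((x # X) ! i))"

lemma path_sum_Nil [simp]: "path_sum f x [] = 0"
  by (simp add: path_sum_def)

lemma path_sum_Cons [simp]: "path_sum f x (y # X) = f x y + path_sum f y X"
proof -
  have "path_sum f x (y # X) = f x y + (\<Sum>i = Suc 1..Suc (length X). f ((x # y # X) ! (i - 1)) ((x # y # X) ! i))"
    unfolding path_sum_def by (subst sum.atLeast_Suc_atMost) simp_all
  also have "(\<Sum>i = Suc 1..Suc (length X). f ((x # y # X) ! (i - 1)) ((x # y # X) ! i)) = path_sum f y X"
    unfolding path_sum_def sum.shift_bounds_cl_Suc_ivl by (intro sum.cong refl) (auto simp: nth_Cons')
  finally show ?thesis .
qed

lemma path_sum_mono: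
  fixes f g :: "'a \<Rightarrow> 'a \<Rightarrow> 'b::ordered_comm_monoid_add"
  assumes "\<And>a b. a \<in> A \<Longrightarrow> b \<in> A \<Longrightarrow> f a b \<le> g a b" "x \<in> A" "set X \<subseteq> A"
  shows "path_sum f x X \<le> path_sum g x X"
  using assms(2,3) by (induction X arbitrary: x) (auto intro: add_mono assms(1))

lemma path_sum_cong:
  assumes "\<And>a b. a \<in> A \<Longrightarrow> b \<in> A \<Longrightarrow> f a b = g a b" "x \<in> A" "set X \<subseteq> A"
  shows "path_sum f x X = path_sum g x X"
  using assms(2,3) by (induction X arbitrary: x) (auto simp: assms(1))

lemma Phi_eq_path_sum: "Phi x X w = path_sum (edge_Phi w) x X"
  by (simp add: Phi_def path_sum_def edge_Phi_def Let_def)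

lemma lazy_finger_cost_eq_path_sum: "lazy_finger_cost T X = path_sum (move_cost T) (value T) X"
  by (simp add: lazy_finger_cost_def path_sum_def)

section \<open>Lower bound on \<open>Phi\<close> and the weight of the visited range\<close>

lemma ivl_subset:
  "a \<in> {1..n} \<Longrightarrow> b \<in> {1..n} \<Longrightarrow> k \<in> {min a b..max a b} \<Longrightarrow> k \<in> {1..n::nat}"
  by (auto simp: min_def max_def split: if_splits)

text \<open>Some move joins two distinct keys and contributes at least 1, while all other summands
  are nonnegative. This pays for additive constants later.\<close>

lemma Phi_ge_1:
  assumes pos: "\<And>k. k \<in> {1..n} \<Longrightarrow> 0 < w k"
    and "x \<in> {1..n}" "set X \<subseteq> {1..n}" "\<not> set X \<subseteq> {x}"
  shows "1 \<le> Phi x X w"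
  using assms(2-4)
proof (induction X arbitrary: x)
  case (Cons y X)
  have pos': "0 < w k" if "k \<in> {min x y..max x y}" for k
    using ivl_subset[of x n y k] that Cons.prems pos by simp
  show ?case
  proof (cases "x = y")
    case True
    then have "1 \<le> Phi y X w" using Cons by auto
    moreover have "0 \<le> edge_Phi w x y" using pos' by (rule edge_Phi_nonneg)
    ultimately show ?thesis by (simp add: Phi_eq_path_sum)
  next
    case False
    have "0 \<le> Phi y X w"
      by (rule Phi_nonneg[of _ n]) (use Cons.prems pos in \<open>auto simp: pos_weights_def\<close>)
    moreover have "1 \<le> edge_Phi w x y" using pos' False by (rule edge_Phi_ge_1)
    ultimately show ?thesis by (simp add: Phi_eq_path_sum)
  qed
qed simp

text \<open>A move with summand \<open>e\<close> spans weight at most \<open>2 powr e\<close> times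
  that of either endpoint, so the weight of the finger position also grows at most by this factor.
  Chaining the moves bounds everything between \<open>x\<close> and a visited key; base 4 leaves
  room for adding the spans.\<close>

lemma wsum_visited_le:
  assumes pos: "\<And>k. k \<in> {1..n} \<Longrightarrow> 0 < w k"
    and "x \<in> {1..n}" "set X \<subseteq> {1..n}" "z \<in> set (x # X)"
  shows "sum w {min x z..max x z} \<le> 4 powr Phi x X w * w x"
  using assms(2-4)
proof (induction X arbitrary: x)
  case Nil
  then show ?case by (simp add: Phi_eq_path_sum)
next
  case (Cons y X)
  let ?e = "edge_Phi w x y" and ?P = "Phi y X w"
  have wx: "0 < w x" "0 < w y" using Cons.prems pos by auto
  have P: "0 \<le> ?P" "0 \<le> Phi x (y # X) w"
    by (rule Phi_nonneg[of _ n]; use Cons.prems pos in \<open>auto simp: pos_weights_def\<close>)+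
  have Phi: "Phi x (y # X) w = ?e + ?P" by (simp add: Phi_eq_path_sum)
  show ?case
  proof (cases "z = x")
    case True
    then show ?thesis using P wx ge_one_powr_ge_zero[of 4 "Phi x (y # X) w"] by simp
  next
    case False
    then have IH: "sum w {min y z..max y z} \<le> 4 powr ?P * w y"
      using Cons by auto
    show ?thesis
    proof (cases "x = y")
      case True
      then show ?thesis using IH Phi wx by (simp add: edge_Phi_self)
    next
      case False
      have pos': "0 < w k" if "k \<in> {min x y..max x y}" for k
        using ivl_subset[of x n y k] that Cons.prems pos by simp
      have e: "1 \<le> ?e" by (rule edge_Phi_ge_1) (use pos' False in auto)
      have z: "z \<in> {1..n}" using Cons.prems by auto
      have xy: "sum w {min x y..max x y} \<le> 2 powr ?e * w x"
        using wsum_eq_powr_edge_Phi[of x y w] pos' mult_left_mono[of "min (w x) (w y)" "w x" "2 powr ?e"]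
        by simp
      have "w y \<le> sum w {min x y..max x y}"
        by (rule member_le_sum) (auto intro!: less_imp_le[OF pos'])
      then have y: "w y \<le> 2 powr ?e * w x" using xy by linarith
      have "sum w {min x z..max x z} \<le> sum w ({min x y..max x y} \<union> {min y z..max y z})"
      proof (rule sum_mono2)
        fix k assume "k \<in> {min x y..max x y} \<union> {min y z..max y z} - {min x z..max x z}"
        then have "k \<in> {1..n}" using ivl_subset[of x n y k] ivl_subset[of y n z k] z Cons.prems by auto
        then show "0 \<le> w k" using pos less_imp_le by blast
      qed auto
      also have "\<dots> \<le> sum w {min x y..max x y} + sum w {min y z..max y z}"
      proof -
        have "0 \<le> sum w ({min x y..max x y} \<inter> {min y z..max y z})"
          by (rule sum_nonneg) (auto intro!: less_imp_le[OF pos'])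
        then show ?thesis by (simp add: sum_Un)
      qed
      also have "\<dots> \<le> 2 powr ?e * w x + 4 powr ?P * (2 powr ?e * w x)"
        by (intro add_mono xy order_trans[OF IH] mult_left_mono y) simp
      also have "\<dots> = (1 + 4 powr ?P) * (2 powr ?e * w x)" by (simp add: algebra_simps)
      \<comment> \<open>A move between distinct keys has \<open>?e \<ge> 1\<close>, so one extra
        factor \<open>2 powr ?e\<close> absorbs the addition of 1; the two such factors combine to
        \<open>4 powr ?e\<close>.\<close>
      also have "\<dots> \<le> (2 powr ?e * 4 powr ?P) * (2 powr ?e * w x)"
      proof (rule mult_right_mono)
        have "1 \<le> (4::real) powr ?P" using P by (simp add: ge_one_powr_ge_zero)
        moreover have "2 powr 1 \<le> (2::real) powr ?e" using e by (intro powr_mono) auto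
        then have "2 * 4 powr ?P \<le> 2 powr ?e * 4 powr ?P" by (intro mult_right_mono) auto
        ultimately show "1 + 4 powr ?P \<le> 2 powr ?e * 4 powr ?P" by linarith
      qed (use wx in simp)
      also have "\<dots> = 4 powr Phi x (y # X) w * w x"
        unfolding Phi using powr_mult[of 2 2 ?e] by (simp add: powr_add)
      finally show ?thesis .
    qed
  qed
qed

text \<open>Depth of \<open>x\<close> and cost of the path must be small in the same tree, so the
  averaging argument is applied to the sum of their functionals.\<close>

lemma ex_bst_path_cost_le:
  assumes pos: "\<And>k. k \<in> {1..n} \<Longrightarrow> 0 < w k" and x: "x \<in> {1..n}" and X: "set X \<subseteq> {1..n}"
  shows "\<exists>T\<in>bsts n. real (node_depth T x) + real_of_int (path_sum (move_cost T) x X)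
    \<le> (ln (sum w {1..x}) - ln (w x)) + (ln (sum w {x..n}) - ln (w x)) + 6 * Phi x X w"
proof -
  let ?I = "{1..n} \<times> {1..n}"
  define F where "F M g = (\<Sum>(k, v)\<in>?I. M k v * g k v)" for M g :: "nat \<Rightarrow> nat \<Rightarrow> real"
  have F_add: "F M (\<lambda>k v. g k v + g' k v) = F M g + F M g'" for M g g'
    unfolding F_def by (simp add: case_prod_unfold distrib_left sum.distrib)
  define A where "A T k v = (of_bool (ancestor T k v) :: real)" for T :: "nat tree" and k v
  have "\<exists>g. (\<forall>T\<in>bsts n. real_of_int (path_sum (move_cost T) x X) \<le> F (A T) g) \<and>
    F (anc_prob w) g \<le> 6 * Phi x X w"
    using x X
  proof (induction X arbitrary: x)
    case Nil
    show ?case by (rule exI[of _ "\<lambda>_ _. 0"]) (simp add: F_def Phi_eq_path_sum)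
  next
    case (Cons y X)
    then obtain g where g: "\<And>T. T \<in> bsts n \<Longrightarrow> real_of_int (path_sum (move_cost T) y X) \<le> F (A T) g"
        "F (anc_prob w) g \<le> 6 * Phi y X w" by force
    obtain g' where g': "\<And>T. T \<in> bsts n \<Longrightarrow> real_of_int (move_cost T x y) \<le> F (A T) g'"
        "F (anc_prob w) g' \<le> 6 * edge_Phi w x y"
      using ex_functional_move_cost[of n w x y, OF pos] Cons.prems unfolding F_def A_def by auto
    show ?case
      using g g' by (intro exI[of _ "\<lambda>k v. g' k v + g k v"]) (auto simp: F_add Phi_eq_path_sum intro: add_mono)
  qed
  then obtain g where g: "\<And>T. T \<in> bsts n \<Longrightarrow> real_of_int (path_sum (move_cost T) x X) \<le> F (A T) g"
    "F (anc_prob w) g \<le> 6 * Phi x X w" by blast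
  \<comment> \<open>The functional with coefficients \<open>d\<close> counts the ancestors of
    \<open>x\<close>, which is its depth plus 1; the 1 cancels against the constant in the bound on
    the expectation.\<close>
  define d where "d k v = (of_bool (v = x) * 1 :: real)" for k v :: nat
  have d: "F M d = (\<Sum>k = 1..n. M k x)" for M
    unfolding F_def d_def by (subst sum_prod_of_bool_eq[OF x]) simp
  have "\<exists>T. bst T \<and> set_tree T = {1..n} \<and> F (A T) (\<lambda>k v. d k v + g k v) \<le> F (anc_prob w) (\<lambda>k v. d k v + g k v)"
    using ex_bst_le_average[of 1 "Suc n" w "\<lambda>k v. d k v + g k v"] pos
    unfolding F_def A_def by (simp add: atLeastLessThanSuc_atLeastAtMost)
  then obtain T where T: "T \<in> bsts n" and le: "F (A T) d + F (A T) g \<le> F (anc_prob w) d + F (anc_prob w) g"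
    unfolding F_add bsts_def by blast
  have "F (A T) d = real (node_depth T x) + 1"
    unfolding d A_def by (rule depth_eq_functional[symmetric]) (use T x in auto)
  moreover have "F (anc_prob w) d \<le> 1 + (ln (sum w {1..x}) - ln (w x)) + (ln (sum w {x..n}) - ln (w x))"
    unfolding d by (rule sum_anc_prob_le) (use pos x in auto)
  ultimately show ?thesis using T g(1)[OF T] g(2) le by (intro bexI[of _ T]) auto
qed

subsection \<open>The upper bound\<close>

lemma ln_wsum_le:
  fixes v s P :: real
  assumes "0 < v" "0 < s" "s \<le> v + 4 powr P * v" "0 \<le> P"
  shows "ln s - ln v \<le> 1 + 2 * P"
proof -
  have "1 \<le> (4::real) powr P" using assms(4) by (simp add: ge_one_powr_ge_zero)
  then have "v \<le> 4 powr P * v" using assms(1) by simp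
  then have "s \<le> 2 * 4 powr P * v" using assms(3) by linarith
  then have "ln s \<le> ln (2 * 4 powr P * v)" using assms by (intro ln_mono) auto
  also have "\<dots> = ln 2 + P * ln 4 + ln v" using assms by (simp add: ln_mult ln_powr)
  also have "ln (4::real) = 2 * ln 2" using ln_realpow[of 2 2] by simp
  finally have "ln s - ln v \<le> ln 2 * (1 + 2 * P)" by (simp add: algebra_simps)
  also have "\<dots> \<le> 1 * (1 + 2 * P)"
    by (rule mult_right_mono) (use assms ln_2_less_1 in auto)
  finally show ?thesis by simp
qed

lemma ex_bst_lazy_finger_cost_le:
  assumes w: "w \<in> pos_weights n" and x: "x \<in> {1..n}" and X: "set X \<subseteq> {1..n}" "\<not> set X \<subseteq> {x}"
  shows "\<exists>T\<in>bsts n. real_of_int (lazy_finger_cost T X) \<le> 12 * Phi x X w"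
proof -
  define lo hi where "lo = Min (set (x # X))" and "hi = Max (set (x # X))"
  have mem: "lo \<in> set (x # X)" "hi \<in> set (x # X)"
    unfolding lo_def hi_def by (intro Min_in Max_in; simp)+
  have range: "set (x # X) \<subseteq> {lo..hi}" unfolding lo_def hi_def by auto
  have pos: "0 < w k" if "k \<in> {1..n}" for k using w that by (simp add: pos_weights_def)
  have n: "0 < n" and wx: "0 < w x" using x pos by auto
  \<comment> \<open>At most \<open>n\<close> keys lie outside the visited range, so with weight
    \<open>w x / n\<close> each they weigh at most \<open>w x\<close> together. No move leaves the
    range, hence \<open>Phi\<close> is unchanged.\<close>
  define w' where "w' k = (if k \<in> {lo..hi} then w k else w x / n)" for k
  have pos': "0 < w' k" if "k \<in> {1..n}" for k using pos[OF that] wx n by (simp add: w'_def)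
  have w'x: "w' x = w x" using range by (simp add: w'_def)
  have "edge_Phi w' a b = edge_Phi w a b" if "a \<in> {lo..hi}" "b \<in> {lo..hi}" for a b
  proof -
    have "sum w' {min a b..max a b} = sum w {min a b..max a b}"
      using that by (intro sum.cong refl) (auto simp: w'_def)
    then show ?thesis using that by (simp add: edge_Phi_def w'_def)
  qed
  then have Phi': "Phi x X w' = Phi x X w"
    unfolding Phi_eq_path_sum by (rule path_sum_cong[of "{lo..hi}"]) (use range in auto)
  have P: "1 \<le> Phi x X w" by (rule Phi_ge_1[of n]) (use pos x X in auto)
  have visited: "sum w {min x z..max x z} \<le> 4 powr Phi x X w * w x" if "z \<in> set (x # X)" for z
    by (rule wsum_visited_le[of n]) (use pos x X that in auto)
  have part: "sum w' J \<le> w x + sum w (J \<inter> {lo..hi})" if "J \<subseteq> {1..n}" for J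
  proof -
    have fin: "finite J" using that finite_subset by blast
    have "sum w' J = sum w' (J - {lo..hi}) + sum w' (J \<inter> {lo..hi})"
      using sum.Int_Diff[OF fin, of w' "{lo..hi}"] by simp
    also have "sum w' (J - {lo..hi}) = card (J - {lo..hi}) * (w x / n)"
    proof -
      have "sum w' (J - {lo..hi}) = (\<Sum>k\<in>J - {lo..hi}. w x / n)"
        by (intro sum.cong) (auto simp: w'_def)
      then show ?thesis by simp
    qed
    also have "\<dots> \<le> n * (w x / n)"
    proof (rule mult_right_mono)
      have "card (J - {lo..hi}) \<le> card {1..n}" using that by (intro card_mono) auto
      then show "real (card (J - {lo..hi})) \<le> real n" by simp
    qed (use wx in simp)
    also have "sum w' (J \<inter> {lo..hi}) = sum w (J \<inter> {lo..hi})"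
      by (intro sum.cong) (auto simp: w'_def)
    finally show ?thesis using n by simp
  qed
  have lohi: "lo \<le> x" "x \<le> hi" "1 \<le> lo" "hi \<le> n" using range mem x X by auto
  have "ln (sum w' {1..x}) - ln (w' x) \<le> 1 + 2 * Phi x X w"
    unfolding w'x
  proof (rule ln_wsum_le)
    have eq: "{1..x} \<inter> {lo..hi} = {min x lo..max x lo}" using lohi by auto
    have "sum w' {1..x} \<le> w x + sum w {min x lo..max x lo}"
      unfolding eq[symmetric] by (rule part) (use x in auto)
    then show "sum w' {1..x} \<le> w x + 4 powr Phi x X w * w x"
      using visited[OF mem(1)] by argo
    show "0 < sum w' {1..x}" using x by (intro sum_pos pos') auto
  qed (use wx P in auto)
  moreover have "ln (sum w' {x..n}) - ln (w' x) \<le> 1 + 2 * Phi x X w"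
    unfolding w'x
  proof (rule ln_wsum_le)
    have eq: "{x..n} \<inter> {lo..hi} = {min x hi..max x hi}" using lohi by auto
    have "sum w' {x..n} \<le> w x + sum w {min x hi..max x hi}"
      unfolding eq[symmetric] by (rule part) (use x in auto)
    then show "sum w' {x..n} \<le> w x + 4 powr Phi x X w * w x"
      using visited[OF mem(2)] by argo
    show "0 < sum w' {x..n}" using x by (intro sum_pos pos') auto
  qed (use wx P in auto)
  moreover obtain T where T: "T \<in> bsts n" and
    le: "real (node_depth T x) + real_of_int (path_sum (move_cost T) x X)
      \<le> (ln (sum w' {1..x}) - ln (w' x)) + (ln (sum w' {x..n}) - ln (w' x)) + 6 * Phi x X w"
    using ex_bst_path_cost_le[of n w', OF pos' x X(1)] Phi' by auto
  \<comment> \<open>The two logarithmic terms are at most \<open>1 + 2 * Phi x X w\<close> each.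
    Together with the path this is \<open>2 + 10 * Phi x X w\<close>, and
    \<open>Phi x X w \<ge> 1\<close> gives the factor 12.\<close>
  ultimately have le': "real (node_depth T x) + real_of_int (path_sum (move_cost T) x X) \<le> 12 * Phi x X w"
    using P by linarith
  obtain y Y where XY: "X = y # Y" using X by (cases X) auto
  have bst: "bst T" "x \<in> set_tree T" "y \<in> set_tree T"
    using T x X XY by (auto simp: bsts_def)
  then have "node_depth T (value T) = 0" by (cases T) auto
  \<comment> \<open>Only the first move depends on the start. From the root it costs at most the
    depth of \<open>y\<close>, and the detour through \<open>x\<close> costs no less because
    \<open>lca T x y\<close> is not deeper than \<open>x\<close>.\<close>
  then have "move_cost T (value T) y \<le> node_depth T x + move_cost T x y"
    using depth_lca_le(1)[OF bst] by (simp add: move_cost_def)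
  then have "lazy_finger_cost T X \<le> node_depth T x + path_sum (move_cost T) x X"
    by (simp add: lazy_finger_cost_eq_path_sum XY)
  then have "real_of_int (lazy_finger_cost T X) \<le> real (node_depth T x) + real_of_int (path_sum (move_cost T) x X)"
    by linarith
  then show ?thesis using le' T by force
qed

subsection \<open>The lower bound\<close>

text \<open>Each subtree contributes a quarter of its own sum, and
  \<open>1 + 2 / 4 + 2 / 4 = 2\<close>.\<close>

lemma sum_quarter_power_depth_le:
  "bst T \<Longrightarrow> (\<Sum>k\<in>set_tree T. (1 / 4 :: real) ^ node_depth T k) \<le> 2"
proof (induction T)
  case (Node l x r)
  have disj: "x \<notin> set_tree l \<union> set_tree r" "set_tree l \<inter> set_tree r = {}"
    using Node.prems by (auto dest: less_asym)
  have "(\<Sum>k\<in>set_tree \<langle>l, x, r\<rangle>. (1 / 4 :: real) ^ node_depth \<langle>l, x, r\<rangle> k)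
      = 1 + ((\<Sum>k\<in>set_tree l. (1 / 4) ^ node_depth \<langle>l, x, r\<rangle> k)
        + (\<Sum>k\<in>set_tree r. (1 / 4) ^ node_depth \<langle>l, x, r\<rangle> k))"
    using disj by (simp add: sum.union_disjoint del: node_depth.simps) simp
  also have "(\<Sum>k\<in>set_tree l. (1 / 4 :: real) ^ node_depth \<langle>l, x, r\<rangle> k)
      = (\<Sum>k\<in>set_tree l. (1 / 4) ^ node_depth l k) / 4"
    unfolding sum_divide_distrib using disj by (intro sum.cong refl) auto
  also have "(\<Sum>k\<in>set_tree r. (1 / 4 :: real) ^ node_depth \<langle>l, x, r\<rangle> k)
      = (\<Sum>k\<in>set_tree r. (1 / 4) ^ node_depth r k) / 4"
    unfolding sum_divide_distrib using disj by (intro sum.cong refl) auto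
  finally show ?case using Node by simp
qed simp

text \<open>Obtained from the recursion for the set of common ancestors by counting, which avoids
  working with the arg-max in \<open>lca\<close>.\<close>

lemma depth_lca_Node:
  assumes bst: "bst \<langle>l, x, r\<rangle>" and ab: "a \<le> b"
  shows "a \<in> set_tree l \<Longrightarrow> b \<in> set_tree l \<Longrightarrow>
      node_depth \<langle>l, x, r\<rangle> (lca \<langle>l, x, r\<rangle> a b) = Suc (node_depth l (lca l a b))"
    and "a \<in> set_tree r \<Longrightarrow> b \<in> set_tree r \<Longrightarrow>
      node_depth \<langle>l, x, r\<rangle> (lca \<langle>l, x, r\<rangle> a b) = Suc (node_depth r (lca r a b))"
    and "a \<in> set_tree \<langle>l, x, r\<rangle> \<Longrightarrow> b \<in> set_tree \<langle>l, x, r\<rangle> \<Longrightarrow> a \<le> x \<Longrightarrow> x \<le> b \<Longrightarrow>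
      node_depth \<langle>l, x, r\<rangle> (lca \<langle>l, x, r\<rangle> a b) = 0"
proof -
  have card_insert: "card (insert x ({u. ancestor t u a} \<inter> S)) = Suc (card ({u. ancestor t u a} \<inter> S))"
    if "x \<notin> set_tree t" for t S
    using that by (intro card_insert_disjoint) (auto dest: ancestor_in_set_tree)
  have x: "x \<notin> set_tree l" "x \<notin> set_tree r" using bst by auto
  show "node_depth \<langle>l, x, r\<rangle> (lca \<langle>l, x, r\<rangle> a b) = Suc (node_depth l (lca l a b))"
    if "a \<in> set_tree l" "b \<in> set_tree l"
  proof -
    have "b < x" using bst that by auto
    then show ?thesis
      using card_common_ancestors[OF bst, of a b] common_ancestors_eq[OF bst, of a b]
        card_common_ancestors[of l a b] card_insert[OF x(1)] bst that ab
      by (simp del: ancestor_Node)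
  qed
  show "node_depth \<langle>l, x, r\<rangle> (lca \<langle>l, x, r\<rangle> a b) = Suc (node_depth r (lca r a b))"
    if "a \<in> set_tree r" "b \<in> set_tree r"
  proof -
    have "x < a" "\<not> b < x" using bst that by (auto dest: less_asym)
    then show ?thesis
      using card_common_ancestors[OF bst, of a b] common_ancestors_eq[OF bst, of a b]
        card_common_ancestors[of r a b] card_insert[OF x(2)] bst that ab
      by (simp del: ancestor_Node)
  qed
  show "node_depth \<langle>l, x, r\<rangle> (lca \<langle>l, x, r\<rangle> a b) = 0"
    if "a \<in> set_tree \<langle>l, x, r\<rangle>" "b \<in> set_tree \<langle>l, x, r\<rangle>" "a \<le> x" "x \<le> b"
  proof -
    have "\<not> b < x" "\<not> x < a" using that by auto
    then show ?thesis
      using card_common_ancestors[OF bst that(1,2)] common_ancestors_eq[OF bst that(1,2) ab]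
      by (simp del: ancestor_Node)
  qed
qed

text \<open>All keys between \<open>a\<close> and \<open>b\<close> lie below their lowest common
  ancestor. Each level of the descent to it scales both sides by \<open>1 / 4\<close>; once the root
  lies in \<open>{a..b}\<close>, the bound 2 for the whole tree applies.\<close>

lemma sum_quarter_power_depth_ivl_le:
  "bst T \<Longrightarrow> a \<in> set_tree T \<Longrightarrow> b \<in> set_tree T \<Longrightarrow> a \<le> b \<Longrightarrow>
    (\<Sum>k\<in>set_tree T \<inter> {a..b}. (1 / 4 :: real) ^ node_depth T k) \<le> 2 * (1 / 4) ^ node_depth T (lca T a b)"
proof (induction T)
  case (Node l x r)
  consider "b < x" | "x < a" | "a \<le> x" "x \<le> b" using not_le by blast
  then show ?case
  proof cases
    case 1
    have ab: "a \<in> set_tree l" "b \<in> set_tree l"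
      using bst_left[OF Node.prems(1)] Node.prems(2,3) 1 le_less_trans[OF Node.prems(4) 1] by blast+
    have "k \<in> set_tree l" if "k \<in> set_tree \<langle>l, x, r\<rangle>" "k \<le> b" for k
      by (rule bst_left[OF Node.prems(1) that(1) le_less_trans[OF that(2) 1]])
    then have "set_tree \<langle>l, x, r\<rangle> \<inter> {a..b} \<subseteq> set_tree l"
      by (meson IntE atLeastAtMost_iff subsetI)
    then have eq: "set_tree \<langle>l, x, r\<rangle> \<inter> {a..b} = set_tree l \<inter> {a..b}" by auto
    have "(\<Sum>k\<in>set_tree l \<inter> {a..b}. (1 / 4 :: real) ^ node_depth \<langle>l, x, r\<rangle> k)
        = (\<Sum>k\<in>set_tree l \<inter> {a..b}. (1 / 4) ^ node_depth l k) / 4"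
      unfolding sum_divide_distrib using Node.prems(1) by (intro sum.cong refl) auto
    then show ?thesis
      unfolding eq depth_lca_Node(1)[OF Node.prems(1,4) ab] using Node.IH(1) Node.prems(1,4) ab by simp
  next
    case 2
    have ab: "a \<in> set_tree r" "b \<in> set_tree r"
      using bst_right[OF Node.prems(1)] Node.prems(2,3) 2 less_le_trans[OF 2 Node.prems(4)] by blast+
    have "k \<in> set_tree r" if "k \<in> set_tree \<langle>l, x, r\<rangle>" "a \<le> k" for k
      by (rule bst_right[OF Node.prems(1) that(1) less_le_trans[OF 2 that(2)]])
    then have "set_tree \<langle>l, x, r\<rangle> \<inter> {a..b} \<subseteq> set_tree r"
      by (meson IntE atLeastAtMost_iff subsetI)
    then have eq: "set_tree \<langle>l, x, r\<rangle> \<inter> {a..b} = set_tree r \<inter> {a..b}" by auto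
    have "(\<Sum>k\<in>set_tree r \<inter> {a..b}. (1 / 4 :: real) ^ node_depth \<langle>l, x, r\<rangle> k)
        = (\<Sum>k\<in>set_tree r \<inter> {a..b}. (1 / 4) ^ node_depth r k) / 4"
      unfolding sum_divide_distrib using Node.prems(1) by (intro sum.cong refl) (auto dest: less_asym)
    then show ?thesis
      unfolding eq depth_lca_Node(2)[OF Node.prems(1,4) ab] using Node.IH(2) Node.prems(1,4) ab by simp
  next
    case 3
    have "(\<Sum>k\<in>set_tree \<langle>l, x, r\<rangle> \<inter> {a..b}. (1 / 4 :: real) ^ node_depth \<langle>l, x, r\<rangle> k)
        \<le> (\<Sum>k\<in>set_tree \<langle>l, x, r\<rangle>. (1 / 4) ^ node_depth \<langle>l, x, r\<rangle> k)"
      by (rule sum_mono2) auto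
    also have "\<dots> \<le> 2" by (rule sum_quarter_power_depth_le[OF Node.prems(1)])
    finally show ?thesis unfolding depth_lca_Node(3)[OF Node.prems(1,4,2,3) 3] by simp
  qed
qed simp

text \<open>With \<open>D\<close> the depth of the lowest common ancestor and \<open>m\<close> that
  of the deeper endpoint, the quotient is at most \<open>2 * 4 ^ (m - D)\<close>, with logarithm
  \<open>1 + 2 * (m - D)\<close>. Both 1 and \<open>m - D\<close> are bounded by the cost of a move
  between distinct keys.\<close>

lemma edge_Phi_depth_le_move_cost:
  assumes T: "T \<in> bsts n" and "a \<in> {1..n}" "b \<in> {1..n}"
  shows "edge_Phi (\<lambda>k. (1 / 4) ^ node_depth T k) a b \<le> 3 * real_of_int (move_cost T a b)"
  using assms(2,3)
proof (induction a b rule: linorder_wlog)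
  case (sym a b)
  then show ?case by (simp only: move_cost_commute[of _ b] edge_Phi_commute[of _ b])
next
  case (le a b)
  let ?w = "\<lambda>k. (1 / 4 :: real) ^ node_depth T k"
  have bst: "bst T" "a \<in> set_tree T" "b \<in> set_tree T" and set: "set_tree T = {1..n}"
    using T le by (auto simp: bsts_def)
  show ?case
  proof (cases "a = b")
    case True
    then show ?thesis using move_cost_self[OF bst(1,2)] by (simp add: edge_Phi_self)
  next
    case False
    define D m where "D = node_depth T (lca T a b)" and "m = max (node_depth T a) (node_depth T b)"
    have D: "D \<le> node_depth T a" "D \<le> node_depth T b"
      using depth_lca_le[OF bst] by (auto simp: D_def)
    then have "D \<le> m" by (simp add: m_def)
    have "set_tree T \<inter> {a..b} = {a..b}" using le set by auto
    then have s: "sum ?w {a..b} \<le> 2 * (1 / 4) ^ D"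
      using sum_quarter_power_depth_ivl_le[OF bst le(1)] by (simp add: D_def)
    have m: "min (?w a) (?w b) = (1 / 4) ^ m"
      unfolding m_def by (auto simp: min_def max_def power_decreasing intro: antisym)
    have "sum ?w {a..b} / min (?w a) (?w b) \<le> 2 * (1 / 4) ^ D / (1 / 4) ^ m"
      unfolding m using s by (intro divide_right_mono) auto
    also have "\<dots> = 2 powr (1 + 2 * real (m - D))"
    proof -
      have "(1 / 4 :: real) ^ m = (1 / 4) ^ D * (1 / 4) ^ (m - D)"
        using \<open>D \<le> m\<close> by (simp flip: power_add)
      then have "2 * (1 / 4) ^ D / (1 / 4) ^ m = (2 * 4 ^ (m - D) :: real)"
        by (simp add: power_divide)
      also have "\<dots> = 2 powr (1 + real (2 * (m - D)))"
        unfolding powr_add powr_realpow[of 2, simplified] by (simp add: power_mult)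
      finally show ?thesis by simp
    qed
    finally have "log 2 (sum ?w {a..b} / min (?w a) (?w b)) \<le> log 2 (2 powr (1 + 2 * real (m - D)))"
      using le(1) by (intro log_mono divide_pos_pos sum_pos) auto
    then have "edge_Phi ?w a b \<le> 1 + 2 * real (m - D)"
      using le(1) by (simp add: edge_Phi_def)
    moreover have "int (m - D) \<le> move_cost T a b"
      using D by (simp add: move_cost_def m_def D_def)
    then have "real (m - D) \<le> real_of_int (move_cost T a b)"
      by linarith
    moreover have "1 \<le> real_of_int (move_cost T a b)"
      using move_cost_pos[OF bst False] by simp
    ultimately show ?thesis by linarith
  qed
qed

theorem theorem2:
  shows "\<exists>c C :: real. 0 < c \<and> 0 < C \<and>
    (\<forall>n\<ge>1. \<forall>m\<ge>1. \<forall>X. length X = m \<and> set X \<subseteq> {1..n} \<longrightarrow>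
      (\<forall>T\<in>bsts n. lazy_finger_cost T X = min_lazy_finger_cost n X \<longrightarrow>
        c * min_Phi n (value T) X \<le> real_of_int (min_lazy_finger_cost n X) \<and>
        real_of_int (min_lazy_finger_cost n X) \<le> C * min_Phi n (value T) X))"
proof (rule exI[of _ "1 / 3"], rule exI[of _ 12], intro conjI allI impI ballI; (elim conjE)?)
  fix n m :: nat and X and T
  assume n: "1 \<le> n" and X: "set X \<subseteq> {1..n}" and T: "T \<in> bsts n"
    and opt: "lazy_finger_cost T X = min_lazy_finger_cost n X"
  define x where "x = value T"
  have x: "x \<in> {1..n}" using T n unfolding x_def by (cases T) (auto simp: bsts_def)
  have cost: "min_lazy_finger_cost n X = path_sum (move_cost T) x X"
    using opt by (simp add: lazy_finger_cost_eq_path_sum x_def)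
  let ?w = "\<lambda>k. (1 / 4 :: real) ^ node_depth T k"
  have "min_Phi n x X \<le> Phi x X ?w"
    unfolding min_Phi_def by (rule cINF_lower[OF bdd_below_Phi[OF x X]]) (simp add: pos_weights_def)
  also have "\<dots> \<le> path_sum (\<lambda>a b. 3 * real_of_int (move_cost T a b)) x X"
    unfolding Phi_eq_path_sum
    by (rule path_sum_mono[of "{1..n}"]) (use edge_Phi_depth_le_move_cost[OF T] x X in auto)
  also have "\<dots> = 3 * real_of_int (path_sum (move_cost T) x X)"
    by (simp add: path_sum_def sum_distrib_left)
  finally show "1 / 3 * min_Phi n (value T) X \<le> real_of_int (min_lazy_finger_cost n X)"
    unfolding cost x_def by simp
  \<comment> \<open>The infimum need not be attained, so the bound is proved for every weight
    vector. The start \<open>x\<close> stays the root of the optimal tree \<open>T\<close>, whereas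
    the comparison tree \<open>T'\<close> may have another root.\<close>
  have "real_of_int (min_lazy_finger_cost n X) / 12 \<le> min_Phi n x X"
    unfolding min_Phi_def
  proof (rule cINF_greatest[OF pos_weights_nonempty])
    fix w assume w: "w \<in> pos_weights n"
    show "real_of_int (min_lazy_finger_cost n X) / 12 \<le> Phi x X w"
    \<comment> \<open>If only \<open>x\<close> is searched, \<open>Phi\<close> vanishes and cannot
      absorb constants; but then the finger never leaves the root of \<open>T\<close> and the
      optimal cost is 0.\<close>
    proof (cases "set X \<subseteq> {x}")
      case True
      have "path_sum (move_cost T) x X = path_sum (\<lambda>_ _. 0) x X"
        by (rule path_sum_cong[of "{x}"]) (use True x T move_cost_self[of T x] in \<open>auto simp: bsts_def\<close>)
      then show ?thesis using Phi_nonneg[OF w x X] cost by (simp add: path_sum_def)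
    next
      case False
      then obtain T' where T': "T' \<in> bsts n" "real_of_int (lazy_finger_cost T' X) \<le> 12 * Phi x X w"
        using ex_bst_lazy_finger_cost_le[OF w x X] by blast
      have "min_lazy_finger_cost n X \<le> lazy_finger_cost T' X"
        unfolding min_lazy_finger_cost_def using T'(1) by (intro Min_le) (auto simp: finite_bsts)
      then show ?thesis using T'(2) by linarith
    qed
  qed
  then show "real_of_int (min_lazy_finger_cost n X) \<le> 12 * min_Phi n (value T) X"
    by (simp add: x_def)
qed simp_all

end
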